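(* Let $U_N$ be the set of Ulam polynomials of degree $N$. Then $|U_1|=1$, $|U_2|=2$, $|U_3|=6$, $|U_4|=23$ and $|U_5|=119$.
   Context: An Ulam polynomial of degree $N\ge1$ is a monic polynomial $x^N+\sum_{m=1}^N\gamma_mx^{N-m}$ with complex coefficients such that $x^N+\sum_{m=1}^N\gamma_mx^{N-m}=\prod_{n=1}^N(x-\gamma_n)$, i.e. its (non-leading) coefficients coincide with its zeros, counted with multiplicity. *)

theory Defs
  imports Complex_Main "HOL-Computational_Algebra.Polynomial"
begin

text \<open>Only the values of \<open>\<gamma>\<close> on \<open>{1..N}\<close> matter; the sequence is otherwise arbitrary.\<close>

definition is_ulam_poly :: "nat \<Rightarrow> complex poly \<Rightarrow> bool" where
  "is_ulam_poly N p \<longleftrightarrow> N \<ge> 1 \<and>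
     (\<exists>\<gamma> :: nat \<Rightarrow> complex.
        p = monom 1 N + (\<Sum>m = 1..N. monom (\<gamma> m) (N - m)) \<and>
        p = (\<Prod>n = 1..N. [:- \<gamma> n, 1:]))"

definition ulam_polys :: "nat \<Rightarrow> complex poly set" where
  "ulam_polys N = {p. is_ulam_poly N p}"

end

theory Submission
  imports Defs "HOL-Analysis.Analysis"
begin

text \<open>
An Ulam polynomial with zero constant term is \<open>x\<close> times one of degree one less, so it suffices to
count those with nonzero constant term in each degree. For these the last equation can be divided by
\<open>\<gamma>\<^sub>N\<close>. Rewriting with divided differences of the polynomial at its own coefficients shows that the
functions on the solution set of the reduced system are spanned by 4, 18 and 96 monomials for
\<open>N = 3, 4, 5\<close>, which bounds the number of solutions; for \<open>N = 4\<close> one of the 18 has \<open>\<gamma>\<^sub>4 = 0\<close>. Conversely,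
4, 17 and 96 distinct solutions are located in disjoint boxes around numerical approximations by
Brouwer's fixed point theorem applied to a preconditioned Newton-type map, with all estimates done
in integer arithmetic on first-order Taylor models.
\<close>

section \<open>First-order Taylor models over the Gaussian integers\<close>

text \<open>After cancelling \<open>\<gamma>\<^sub>N\<close> the equations have degrees 1, ..., N -
  1, N - 1, so 4, 18 and 96 are the Bezout numbers (N - 1) * (N - 1)!. Accumulated over the degrees
  they would give N! polynomials; the zero lost in degree 4 lowers 24 to 23, and the loss is
  inherited in degree 5.

  Algebra bounds the number of solutions but does not see whether they are distinct; numerical boxes
  show distinctness but not completeness. Hence both halves. Since the algebra caps the number, each
  box only has to contain some zero, which is what Brouwer's theorem delivers. Disjointness of boxes
  in four complex dimensions is reduced to the distances between integers, one real linear
  functional being evaluated on every box.\<close>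

type_synonym gint = "int \<times> int"
type_synonym 'a quad = "'a \<times> 'a \<times> 'a \<times> 'a"

fun gval :: "gint \<Rightarrow> complex" where
  "gval (x, y) = Complex (of_int x) (of_int y)"
text \<open>The l1 norm stands in for the modulus because it is an integer; it is at least the
  modulus and at most twice the modulus.\<close>

fun gabs :: "gint \<Rightarrow> int" where
  "gabs (x, y) = \<bar>x\<bar> + \<bar>y\<bar>"
fun gadd :: "gint \<Rightarrow> gint \<Rightarrow> gint" where
  "gadd (x, y) (x', y') = (x + x', y + y')"
fun gmul :: "gint \<Rightarrow> gint \<Rightarrow> gint" where
  "gmul (x, y) (x', y') = (x * x' - y * y', x * y' + y * x')"
fun gcnj :: "gint \<Rightarrow> gint" where
  "gcnj (x, y) = (x, - y)"

lemma gval_gadd: "gval (gadd u v) = gval u + gval v"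
  by (cases u; cases v) (simp add: complex_eq_iff)
lemma gval_gmul: "gval (gmul u v) = gval u * gval v"
  by (cases u; cases v) (simp add: complex_eq_iff)
lemma gval_of_int: "gval (k, 0) = of_int k"
  by (simp add: complex_eq_iff)
lemma norm_gval_le: "cmod (gval u) \<le> of_int (gabs u)"
  by (cases u) (simp add: complex_norm cmod_le[of "Complex _ _", simplified complex_norm, simplified])
lemma gabs_le_norm: "of_int (gabs u) \<le> 2 * cmod (gval u)"
proof (cases u)
  case (Pair x y)
  then show ?thesis
    using abs_Re_le_cmod[of "gval u"] abs_Im_le_cmod[of "gval u"] by simp
qed

text \<open>An affine function of a point of the unit polydisc, with a uniform error bound. A plain
  interval would forget how the value depends on the point, and \<open>isolates\<close> compares
  exactly this dependence with a diagonal map.\<close>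

datatype tmodel = TM (centre: gint) gint gint gint gint int

fun encl :: "complex quad \<Rightarrow> complex \<Rightarrow> tmodel \<Rightarrow> bool" where
  "encl (w1, w2, w3, w4) z (TM v a b c d e) \<longleftrightarrow>
     cmod (z - (gval v + (gval a * w1 + gval b * w2 + gval c * w3 + gval d * w4))) \<le> of_int e"

fun radius :: "tmodel \<Rightarrow> int" where
  "radius (TM v a b c d e) = gabs a + gabs b + gabs c + gabs d + e"

fun tadd :: "tmodel \<Rightarrow> tmodel \<Rightarrow> tmodel" where
  "tadd (TM v a b c d e) (TM v' a' b' c' d' e') =
     TM (gadd v v') (gadd a a') (gadd b b') (gadd c c') (gadd d d') (e + e')"

fun tmul :: "tmodel \<Rightarrow> tmodel \<Rightarrow> tmodel" where
  "tmul (TM v a b c d e) (TM v' a' b' c' d' e') =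
     TM (gmul v v')
       (gadd (gmul v a') (gmul v' a)) (gadd (gmul v b') (gmul v' b))
       (gadd (gmul v c') (gmul v' c)) (gadd (gmul v d') (gmul v' d))
       (gabs v * e' + gabs v' * e +
        radius (TM v a b c d e) * radius (TM v' a' b' c' d' e'))"

definition tconst :: "gint \<Rightarrow> tmodel" where
  "tconst g = TM g (0, 0) (0, 0) (0, 0) (0, 0) 0"

fun tscale :: "int \<Rightarrow> tmodel \<Rightarrow> tmodel" where
  "tscale k (TM (v, v') (a, a') (b, b') (c, c') (d, d') e) =
     TM (k * v, k * v') (k * a, k * a') (k * b, k * b') (k * c, k * c') (k * d, k * d') (\<bar>k\<bar> * e)"

definition polydisc :: "complex quad set" where
  "polydisc = cball 0 1 \<times> cball 0 1 \<times> cball 0 1 \<times> cball 0 1"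

lemma encl_tconst: "encl w (gval g) (tconst g)"
  by (cases w) (simp add: tconst_def complex_eq_iff zero_complex.ctr[symmetric])

lemma encl_tadd:
  assumes "encl w x X" and "encl w y Y"
  shows "encl w (x + y) (tadd X Y)"
proof -
  obtain w1 w2 w3 w4 v a b c d e v' a' b' c' d' e'
    where eq: "w = (w1, w2, w3, w4)" "X = TM v a b c d e" "Y = TM v' a' b' c' d' e'"
    by (metis prod_cases4 tmodel.exhaust)
  let ?L = "gval v + (gval a * w1 + gval b * w2 + gval c * w3 + gval d * w4)"
  let ?L' = "gval v' + (gval a' * w1 + gval b' * w2 + gval c' * w3 + gval d' * w4)"
  have "cmod ((x - ?L) + (y - ?L')) \<le> of_int e + of_int e'"
    using assms by (intro norm_triangle_le add_mono) (simp_all add: eq)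
  then show ?thesis
    by (simp add: eq gval_gadd algebra_simps)
qed

lemma linear_part_bound:
  assumes "(w1, w2, w3, w4) \<in> polydisc"
  shows "cmod (gval a * w1 + gval b * w2 + gval c * w3 + gval d * w4)
    \<le> of_int (gabs a + gabs b + gabs c + gabs d)"
proof -
  have *: "cmod (gval a * w) \<le> of_int (gabs a)" if "cmod w \<le> 1" for a w
  proof -
    have "cmod (gval a * w) \<le> of_int (gabs a) * 1"
      unfolding norm_mult by (intro mult_mono norm_gval_le that) (cases a, auto)
    then show ?thesis by simp
  qed
  show ?thesis
    using assms unfolding polydisc_def
    by (simp add: norm_triangle_le add_mono *)
qed

lemma encl_radius:
  assumes "encl w z X" and "w \<in> polydisc"
  shows "cmod (z - gval (centre X)) \<le> of_int (radius X)"
proof -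
  obtain w1 w2 w3 w4 v a b c d e
    where eq: "w = (w1, w2, w3, w4)" "X = TM v a b c d e"
    by (metis prod_cases4 tmodel.exhaust)
  let ?L = "gval a * w1 + gval b * w2 + gval c * w3 + gval d * w4"
  have "cmod (z - gval v) = cmod (?L + (z - (gval v + ?L)))"
    by simp
  also have "\<dots> \<le> of_int (gabs a + gabs b + gabs c + gabs d) + of_int e"
    using assms by (intro norm_triangle_mono linear_part_bound) (simp_all add: eq)
  finally show ?thesis by (simp add: eq)
qed

lemma encl_tmul:
  assumes X: "encl w x X" and Y: "encl w y Y" and w: "w \<in> polydisc"
  shows "encl w (x * y) (tmul X Y)"
proof -
  obtain w1 w2 w3 w4 v a b c d e v' a' b' c' d' e'
    where eq: "w = (w1, w2, w3, w4)" "X = TM v a b c d e" "Y = TM v' a' b' c' d' e'"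
    by (metis prod_cases4 tmodel.exhaust)
  let ?L = "gval a * w1 + gval b * w2 + gval c * w3 + gval d * w4"
  let ?L' = "gval a' * w1 + gval b' * w2 + gval c' * w3 + gval d' * w4"
  define r where "r = x - (gval v + ?L)"
  define r' where "r' = y - (gval v' + ?L')"
  have r: "cmod r \<le> of_int e" and r': "cmod r' \<le> of_int e'"
    using X Y by (simp_all add: eq r_def r'_def)
  have s: "cmod (x - gval v) \<le> of_int (radius X)" "cmod (y - gval v') \<le> of_int (radius Y)"
    using encl_radius[OF X w] encl_radius[OF Y w] by (simp_all add: eq)
  have "x * y - (gval (gmul v v') + (gval (gadd (gmul v a') (gmul v' a)) * w1
      + gval (gadd (gmul v b') (gmul v' b)) * w2 + gval (gadd (gmul v c') (gmul v' c)) * w3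
      + gval (gadd (gmul v d') (gmul v' d)) * w4))
      = gval v * r' + gval v' * r + (x - gval v) * (y - gval v')"
    by (simp add: gval_gadd gval_gmul r_def r'_def algebra_simps)
  moreover have "cmod (gval v * r' + gval v' * r + (x - gval v) * (y - gval v'))
      \<le> of_int (gabs v) * of_int e' + of_int (gabs v') * of_int e
        + of_int (radius X) * of_int (radius Y)"
    using r r' s norm_gval_le[of v] norm_gval_le[of v']
    by (intro norm_triangle_le add_mono) (auto simp only: norm_mult intro!: mult_mono
        intro: order_trans[OF norm_ge_zero])
  ultimately show ?thesis
    by (simp add: eq del: radius.simps)
qed

lemma encl_tscale:
  assumes "encl w x X"
  shows "encl w (of_int k * x) (tscale k X)"
proof -
  obtain w1 w2 w3 w4 v v2 a a2 b b2 c c2 d d2 e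
    where eq: "w = (w1, w2, w3, w4)" "X = TM (v, v2) (a, a2) (b, b2) (c, c2) (d, d2) e"
    by (metis prod_cases4 tmodel.exhaust prod.exhaust)
  have g: "gval (k * p, k * q) = of_int k * gval (p, q)" for p q
    by (simp add: complex_eq_iff)
  let ?L = "gval (v, v2) + (gval (a, a2) * w1 + gval (b, b2) * w2 + gval (c, c2) * w3 + gval (d, d2) * w4)"
  have "cmod (of_int k * (x - ?L)) \<le> of_int (\<bar>k\<bar> * e)"
    using assms by (simp add: eq norm_mult mult_left_mono del: gval.simps)
  then show ?thesis
    by (simp only: eq encl.simps tscale.simps g) (simp add: algebra_simps del: gval.simps)
qed

text \<open>Brouwer's theorem for \<open>w \<mapsto> w - f w / k\<close>.\<close>

lemma continuous_on_common_zero: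
  fixes f1 f2 f3 f4 :: "complex quad \<Rightarrow> complex" and k1 k2 k3 k4 :: real
  assumes cont: "continuous_on polydisc f1" "continuous_on polydisc f2"
      "continuous_on polydisc f3" "continuous_on polydisc f4"
    and pos: "k1 > 0" "k2 > 0" "k3 > 0" "k4 > 0"
    and close: "\<And>w1 w2 w3 w4. (w1, w2, w3, w4) \<in> polydisc \<Longrightarrow>
      cmod (f1 (w1, w2, w3, w4) - complex_of_real k1 * w1) \<le> k1 \<and> cmod (f2 (w1, w2, w3, w4) - complex_of_real k2 * w2) \<le> k2 \<and>
      cmod (f3 (w1, w2, w3, w4) - complex_of_real k3 * w3) \<le> k3 \<and> cmod (f4 (w1, w2, w3, w4) - complex_of_real k4 * w4) \<le> k4"
  obtains w where "w \<in> polydisc" "f1 w = 0" "f2 w = 0" "f3 w = 0" "f4 w = 0"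
proof -
  define G where "G w = (fst w - f1 w / k1, fst (snd w) - f2 w / k2,
    fst (snd (snd w)) - f3 w / k3, snd (snd (snd w)) - f4 w / k4)" for w
  have unit: "cmod (w - z / complex_of_real k) \<le> 1" if "cmod (z - complex_of_real k * w) \<le> k" "k > 0" for w z k
  proof -
    have "cmod (w - z / k) = cmod ((z - k * w) / k)"
      using that(2) by (simp add: norm_minus_commute diff_divide_distrib)
    also have "\<dots> \<le> 1"
      using that by (simp add: norm_divide)
    finally show ?thesis .
  qed
  have "compact polydisc" "convex polydisc"
    by (simp_all add: polydisc_def compact_Times convex_Times)
  moreover have "polydisc \<noteq> {}"
    by (auto simp: polydisc_def)
  moreover have "continuous_on polydisc G"
    unfolding G_def using pos by (intro continuous_intros cont) auto
  moreover have "G \<in> polydisc \<rightarrow> polydisc"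
  proof
    fix w assume w: "w \<in> polydisc"
    obtain w1 w2 w3 w4 where "w = (w1, w2, w3, w4)"
      by (metis prod_cases4)
    then show "G w \<in> polydisc"
      using close[of w1 w2 w3 w4] w pos by (auto simp: G_def polydisc_def intro!: unit)
  qed
  ultimately obtain w where "w \<in> polydisc" "G w = w"
    using brouwer[of polydisc G] by blast
  moreover obtain w1 w2 w3 w4 where "w = (w1, w2, w3, w4)"
    by (metis prod_cases4)
  ultimately show ?thesis
    using pos by (intro that[of w]) (auto simp: G_def)
qed

section \<open>Certifying a zero in an affine box\<close>

fun tval :: "complex quad \<Rightarrow> tmodel \<Rightarrow> complex" where
  "tval (w1, w2, w3, w4) (TM v a b c d e) =
     gval v + (gval a * w1 + gval b * w2 + gval c * w3 + gval d * w4)"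

fun quad_all2 :: "('a \<Rightarrow> 'b \<Rightarrow> bool) \<Rightarrow> 'a quad \<Rightarrow> 'b quad \<Rightarrow> bool" where
  "quad_all2 P (a, b, c, d) (a', b', c', d') \<longleftrightarrow> P a a' \<and> P b b' \<and> P c c' \<and> P d d'"

fun map_quad :: "('a \<Rightarrow> 'b) \<Rightarrow> 'a quad \<Rightarrow> 'b quad" where
  "map_quad f (a, b, c, d) = (f a, f b, f c, f d)"

definition size_le :: "int \<Rightarrow> tmodel \<Rightarrow> bool" where
  "size_le k X \<longleftrightarrow> gabs (centre X) + radius X \<le> k"

lemma size_le_norm:
  assumes "encl w z X" "w \<in> polydisc" "size_le k X"
  shows "cmod z \<le> of_int k"
proof -
  have "cmod z \<le> cmod (gval (centre X)) + cmod (z - gval (centre X))"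
    using norm_triangle_ineq[of "gval (centre X)" "z - gval (centre X)"] by simp
  also have "\<dots> \<le> of_int (gabs (centre X)) + of_int (radius X)"
    by (intro add_mono norm_gval_le encl_radius[OF assms(1,2)])
  also have "\<dots> \<le> of_int k"
    using assms(3) unfolding size_le_def by linarith
  finally show ?thesis .
qed

text \<open>The added models represent \<open>- k1 * w1\<close> to \<open>- k4 * w4\<close>, so the
  four size conditions are the hypotheses of \<open>continuous_on_common_zero\<close>.\<close>

fun isolates :: "int quad \<Rightarrow> tmodel quad \<Rightarrow> bool" where
  "isolates (k1, k2, k3, k4) (A, B, C, D) \<longleftrightarrow>
     0 < k1 \<and> 0 < k2 \<and> 0 < k3 \<and> 0 < k4 \<and>
     size_le k1 (tadd A (TM (0, 0) (- k1, 0) (0, 0) (0, 0) (0, 0) 0)) \<and>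
     size_le k2 (tadd B (TM (0, 0) (0, 0) (- k2, 0) (0, 0) (0, 0) 0)) \<and>
     size_le k3 (tadd C (TM (0, 0) (0, 0) (0, 0) (- k3, 0) (0, 0) 0)) \<and>
     size_le k4 (tadd D (TM (0, 0) (0, 0) (0, 0) (0, 0) (- k4, 0) 0))"

fun remainder :: "tmodel \<Rightarrow> int" where
  "remainder (TM v a b c d e) = e"

text \<open>Without remainders the models parametrise the box exactly by the polydisc, through
  \<open>tval\<close>.\<close>

fun affine_box :: "tmodel quad \<Rightarrow> bool" where
  "affine_box (A, B, C, D) \<longleftrightarrow>
     remainder A = 0 \<and> remainder B = 0 \<and> remainder C = 0 \<and> remainder D = 0"

lemma encl_tval: "remainder X = 0 \<Longrightarrow> encl w (tval w X) X"
  by (cases w; cases X) simp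

lemma continuous_on_tval: "continuous_on S (\<lambda>w. tval w X)"
proof (cases X)
  case (TM v a b c d e)
  have "(\<lambda>w. tval w X) = (\<lambda>w. gval v + (gval a * fst w + gval b * fst (snd w)
      + gval c * fst (snd (snd w)) + gval d * snd (snd (snd w))))"
    by (auto simp: TM)
  then show ?thesis
    by (simp only:) (intro continuous_intros)
qed

definition encloses :: "(complex quad \<Rightarrow> complex quad) \<Rightarrow> (tmodel quad \<Rightarrow> tmodel quad) \<Rightarrow> bool" where
  "encloses f F \<longleftrightarrow>
     (\<forall>w \<in> polydisc. \<forall>x X. quad_all2 (encl w) x X \<longrightarrow> quad_all2 (encl w) (f x) (F X))"

text \<open>The system is pulled back to the polydisc along the parametrisation of the box. The
  model \<open>F X\<close> does not depend on the point \<open>w\<close>, so one integer computation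
  yields the estimates on the whole polydisc.\<close>

lemma isolates_zero:
  assumes encl: "encloses f F" and cont: "continuous_on UNIV f"
    and box: "affine_box X" and iso: "isolates k (F X)"
  obtains w where "w \<in> polydisc" "f (map_quad (tval w) X) = (0, 0, 0, 0)"
proof -
  obtain k1 k2 k3 k4 where k: "k = (k1, k2, k3, k4)"
    by (metis prod_cases4)
  obtain A B C D where X: "X = (A, B, C, D)"
    by (metis prod_cases4)
  obtain P Q R S where FX: "F X = (P, Q, R, S)"
    by (metis prod_cases4)
  define g where "g w = f (tval w A, tval w B, tval w C, tval w D)" for w
  have cont_g: "continuous_on polydisc g"
    unfolding g_def
    by (intro continuous_on_compose2[OF cont] continuous_on_Pair continuous_on_tval) auto
  have encl_g: "quad_all2 (encl w) (g w) (P, Q, R, S)" if "w \<in> polydisc" for w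
    using encl that box unfolding encloses_def g_def FX[symmetric] X
    by (simp add: encl_tval)
  have lin: "encl (w1, w2, w3, w4) (- (of_int l * w1)) (TM (0, 0) (- l, 0) (0, 0) (0, 0) (0, 0) 0)"
    "encl (w1, w2, w3, w4) (- (of_int l * w2)) (TM (0, 0) (0, 0) (- l, 0) (0, 0) (0, 0) 0)"
    "encl (w1, w2, w3, w4) (- (of_int l * w3)) (TM (0, 0) (0, 0) (0, 0) (- l, 0) (0, 0) 0)"
    "encl (w1, w2, w3, w4) (- (of_int l * w4)) (TM (0, 0) (0, 0) (0, 0) (0, 0) (- l, 0) 0)"
    for w1 w2 w3 w4 l
    by (simp_all only: encl.simps gval_of_int) simp_all
  have "k1 > 0" "k2 > 0" "k3 > 0" "k4 > 0"
    using iso by (simp_all add: k FX)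
  obtain w where "w \<in> polydisc" "fst (g w) = 0" "fst (snd (g w)) = 0"
    "fst (snd (snd (g w))) = 0" "snd (snd (snd (g w))) = 0"
  proof (rule continuous_on_common_zero)
    fix w1 w2 w3 w4 assume w: "(w1, w2, w3, w4) \<in> polydisc"
    obtain z1 z2 z3 z4 where z: "g (w1, w2, w3, w4) = (z1, z2, z3, z4)"
      by (metis prod_cases4)
    have e: "encl (w1, w2, w3, w4) z1 P" "encl (w1, w2, w3, w4) z2 Q"
        "encl (w1, w2, w3, w4) z3 R" "encl (w1, w2, w3, w4) z4 S"
      using encl_g[OF w] by (simp_all add: z)
    have s: "size_le k1 (tadd P (TM (0, 0) (- k1, 0) (0, 0) (0, 0) (0, 0) 0))"
      "size_le k2 (tadd Q (TM (0, 0) (0, 0) (- k2, 0) (0, 0) (0, 0) 0))"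
      "size_le k3 (tadd R (TM (0, 0) (0, 0) (0, 0) (- k3, 0) (0, 0) 0))"
      "size_le k4 (tadd S (TM (0, 0) (0, 0) (0, 0) (0, 0) (- k4, 0) 0))"
      using iso by (simp_all add: k FX)
    show "cmod (fst (g (w1, w2, w3, w4)) - complex_of_real (real_of_int k1) * w1) \<le> real_of_int k1 \<and>
      cmod (fst (snd (g (w1, w2, w3, w4))) - complex_of_real (real_of_int k2) * w2) \<le> real_of_int k2 \<and>
      cmod (fst (snd (snd (g (w1, w2, w3, w4)))) - complex_of_real (real_of_int k3) * w3) \<le> real_of_int k3 \<and>
      cmod (snd (snd (snd (g (w1, w2, w3, w4)))) - complex_of_real (real_of_int k4) * w4) \<le> real_of_int k4"
      using size_le_norm[OF encl_tadd[OF e(1) lin(1)[of w1 w2 w3 w4 k1]] w s(1)]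
        size_le_norm[OF encl_tadd[OF e(2) lin(2)[of w1 w2 w3 w4 k2]] w s(2)]
        size_le_norm[OF encl_tadd[OF e(3) lin(3)[of w1 w2 w3 w4 k3]] w s(3)]
        size_le_norm[OF encl_tadd[OF e(4) lin(4)[of w1 w2 w3 w4 k4]] w s(4)]
      by (simp add: z)
  qed (use \<open>k1 > 0\<close> \<open>k2 > 0\<close> \<open>k3 > 0\<close> \<open>k4 > 0\<close> in
      \<open>auto intro!: continuous_intros cont_g\<close>)
  then show ?thesis
    by (intro that[of w]) (auto simp: g_def X prod_eq_iff)
qed

fun linear_form :: "gint quad \<Rightarrow> complex quad \<Rightarrow> complex" where
  "linear_form (k, l, m, n) (a, b, c, d) = gval k * a + gval l * b + (gval m * c + gval n * d)"

fun tlinear_form :: "gint quad \<Rightarrow> tmodel quad \<Rightarrow> tmodel" where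
  "tlinear_form (k, l, m, n) (A, B, C, D) =
     tadd (tadd (tmul (tconst k) A) (tmul (tconst l) B))
          (tadd (tmul (tconst m) C) (tmul (tconst n) D))"

lemma encl_linear_form:
  assumes "quad_all2 (encl w) x X" "w \<in> polydisc"
  shows "encl w (linear_form k x) (tlinear_form k X)"
proof -
  obtain k1 k2 k3 k4 a b c d A B C D
    where "k = (k1, k2, k3, k4)" "x = (a, b, c, d)" "X = (A, B, C, D)"
    by (metis prod_cases4)
  then show ?thesis
    using assms by (simp add: encl_tconst encl_tadd encl_tmul)
qed

text \<open>The last conjunct keeps the form \<open>M\<close> away from zero on the box; its factor
  2 pays for \<open>gabs\<close> being up to twice the modulus. For \<open>M\<close> the last
  coefficient is taken, for \<open>K\<close> a form whose real part tells the zeros apart.\<close>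

definition box_ok :: "(tmodel quad \<Rightarrow> tmodel quad) \<Rightarrow> int quad \<Rightarrow> gint quad \<Rightarrow> int \<Rightarrow> gint quad
    \<Rightarrow> tmodel quad \<Rightarrow> bool" where
  "box_ok F k K r M X \<longleftrightarrow> affine_box X \<and> isolates k (F X) \<and>
     radius (tlinear_form K X) \<le> r \<and>
     2 * radius (tlinear_form M X) < gabs (centre (tlinear_form M X))"

text \<open>Rounded real part of a linear form that takes well-separated values on the boxes.\<close>

definition box_key :: "gint quad \<Rightarrow> tmodel quad \<Rightarrow> int" where
  "box_key K X = fst (centre (tlinear_form K X))"

lemma box_ok_zero:
  assumes "encloses f F" "continuous_on UNIV f" "box_ok F k K r M X"
  shows "\<exists>x. f x = (0, 0, 0, 0) \<and> linear_form M x \<noteq> 0 \<and>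
    \<bar>Re (linear_form K x) - box_key K X\<bar> \<le> r"
proof -
  obtain w where w: "w \<in> polydisc" "f (map_quad (tval w) X) = (0, 0, 0, 0)"
    using isolates_zero[OF assms(1,2)] assms(3) unfolding box_ok_def by metis
  define x where "x = map_quad (tval w) X"
  have "quad_all2 (encl w) x X"
    using assms(3) by (cases X) (simp add: x_def box_ok_def encl_tval)
  then have near: "cmod (linear_form L x - gval (centre (tlinear_form L X))) \<le> radius (tlinear_form L X)" for L
    using encl_radius encl_linear_form w(1) by blast
  have "linear_form M x \<noteq> 0"
    using near[of M] gabs_le_norm[of "centre (tlinear_form M X)"] assms(3)
    by (auto simp: box_ok_def)
  moreover have "\<bar>Re (linear_form K x) - box_key K X\<bar> \<le> r"
  proof -
    have "\<bar>Re (linear_form K x) - box_key K X\<bar> = \<bar>Re (linear_form K x - gval (centre (tlinear_form K X)))\<bar>"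
      by (cases "centre (tlinear_form K X)") (simp add: box_key_def)
    also have "\<dots> \<le> r"
      using abs_Re_le_cmod near[of K] assms(3) unfolding box_ok_def
      by (meson of_int_le_iff order_trans)
    finally show ?thesis .
  qed
  ultimately show ?thesis
    using w(2) x_def by blast
qed

section \<open>Counting zeros by separated keys\<close>

fun separated :: "int \<Rightarrow> int list \<Rightarrow> bool" where
  "separated r [] \<longleftrightarrow> True"
| "separated r (k # ks) \<longleftrightarrow> list_all (\<lambda>l. 2 * r < \<bar>k - l\<bar>) ks \<and> separated r ks"

text \<open>A point within \<open>r\<close> of one key is more than \<open>r\<close> away from all
  the others, so point and key can be removed together.\<close>

lemma separated_length_le_card:
  fixes key :: "'a \<Rightarrow> real"
  assumes "finite A" "separated r ks" "\<forall>k \<in> set ks. \<exists>x \<in> A. \<bar>key x - of_int k\<bar> \<le> of_int r"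
  shows "length ks \<le> card A"
  using assms
proof (induction ks arbitrary: A)
  case (Cons k ks)
  obtain x where x: "x \<in> A" "\<bar>key x - of_int k\<bar> \<le> of_int r"
    using Cons.prems(3) by auto
  have "\<exists>y \<in> A - {x}. \<bar>key y - of_int l\<bar> \<le> of_int r" if l: "l \<in> set ks" for l
  proof -
    obtain y where y: "y \<in> A" "\<bar>key y - of_int l\<bar> \<le> of_int r"
      using Cons.prems(3) l by auto
    have "2 * r < \<bar>k - l\<bar>"
      using Cons.prems(2) l by (auto simp: list_all_iff)
    then have "2 * real_of_int r < \<bar>real_of_int k - real_of_int l\<bar>"
      by linarith
    then have "y \<noteq> x"
      using x(2) y(2) by auto
    then show ?thesis
      using y by blast
  qed
  then have "length ks \<le> card (A - {x})"
    using Cons.prems by (intro Cons.IH) auto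
  then show ?case
    using x(1) Cons.prems(1) by (simp add: card_Diff_singleton) (metis Suc_le_eq card_gt_0_iff empty_iff diff_Suc_1 Suc_pred not_less_eq_eq)
qed simp

lemma length_boxes_le_card:
  assumes "encloses f F" "continuous_on UNIV f"
    and "list_all (box_ok F k K r M) Xs" "separated r (map (box_key K) Xs)"
    and "finite {x. f x = (0, 0, 0, 0) \<and> linear_form M x \<noteq> 0}"
  shows "length Xs \<le> card {x. f x = (0, 0, 0, 0) \<and> linear_form M x \<noteq> 0}"
proof -
  have "length (map (box_key K) Xs) \<le> card {x. f x = (0, 0, 0, 0) \<and> linear_form M x \<noteq> 0}"
  proof (rule separated_length_le_card[OF assms(5,4), where key = "\<lambda>x. Re (linear_form K x)"])
    show "\<forall>l \<in> set (map (box_key K) Xs). \<exists>x \<in> {x. f x = (0, 0, 0, 0) \<and> linear_form M x \<noteq> 0}.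
        \<bar>Re (linear_form K x) - of_int l\<bar> \<le> of_int r"
      using box_ok_zero[OF assms(1,2)] assms(3) unfolding list_all_iff set_map by blast
  qed
  then show ?thesis by simp
qed

section \<open>Counting points by rewriting of monomials\<close>

text \<open>Gaussian elimination: the points of \<open>S\<close> index the unknowns and
  \<open>B\<close> indexes the equations, and each step removes one of each.\<close>

lemma nontrivial_homogeneous_solution:
  fixes A :: "'b \<Rightarrow> 'a \<Rightarrow> 'k :: field"
  assumes "finite B" "finite S" "card B < card S"
  shows "\<exists>l. (\<exists>x \<in> S. l x \<noteq> 0) \<and> (\<forall>b \<in> B. (\<Sum>x \<in> S. l x * A b x) = 0)"
  using assms
proof (induction B arbitrary: S A rule: finite_induct)
  case empty
  then have "S \<noteq> {}"
    by auto
  then show ?case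
    by (intro exI[of _ "\<lambda>_. 1"]) auto
next
  case (insert b B)
  show ?case
  proof (cases "\<forall>x \<in> S. A b x = 0")
    case True
    then have "(\<Sum>x \<in> S. l x * A b x) = 0" for l
      by simp
    then show ?thesis
      using insert.IH[of S A] insert by auto
  next
    case False
    then obtain x0 where x0: "x0 \<in> S" "A b x0 \<noteq> 0"
      by auto
    \<comment> \<open>The unknown at \<open>x0\<close> is eliminated from the remaining equations by
      means of the equation \<open>b\<close>, with pivot \<open>A b x0\<close>.\<close>
    define A' where "A' c x = A c x - A c x0 * A b x / A b x0" for c x
    have "card B < card (S - {x0})"
      using insert.prems insert.hyps x0 by (simp add: card_Diff_singleton)
    then obtain l where l: "\<exists>x \<in> S - {x0}. l x \<noteq> 0"
        "\<forall>c \<in> B. (\<Sum>x \<in> S - {x0}. l x * A' c x) = 0"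
      using insert.IH[of "S - {x0}" A'] insert.prems by blast
    define s where "s = (\<Sum>x \<in> S - {x0}. l x * A b x)"
    \<comment> \<open>The value forced at \<open>x0\<close> by the equation
      \<open>b\<close>.\<close>
    define l' where "l' = l(x0 := - s / A b x0)"
    have sum: "(\<Sum>x \<in> S. l' x * A c x) = (\<Sum>x \<in> S - {x0}. l x * A c x) - s / A b x0 * A c x0" for c
    proof -
      have "(\<Sum>x \<in> S - {x0}. l' x * A c x) = (\<Sum>x \<in> S - {x0}. l x * A c x)"
        by (intro sum.cong) (auto simp: l'_def)
      then show ?thesis
        using insert.prems x0 by (simp add: sum.remove l'_def)
    qed
    have "(\<Sum>x \<in> S. l' x * A c x) = 0" if "c \<in> insert b B" for c
    proof (cases "c = b")
      case True
      then show ?thesis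
        using x0 by (simp add: sum flip: s_def)
    next
      case False
      have "(\<Sum>x \<in> S - {x0}. l x * A' c x) = (\<Sum>x \<in> S - {x0}. l x * A c x) - s / A b x0 * A c x0"
        by (simp add: A'_def s_def sum_subtractf sum_distrib_left sum_distrib_right sum_divide_distrib algebra_simps)
      then show ?thesis
        using False that l(2) by (simp add: sum)
    qed
    moreover have "\<exists>x \<in> S. l' x \<noteq> 0"
      using l(1) by (auto simp: l'_def)
    ultimately show ?thesis
      by blast
  qed
qed

section \<open>Monomial functions and weighted exponents\<close>

fun mon :: "nat quad \<Rightarrow> complex quad \<Rightarrow> complex" where
  "mon (i, j, k, l) (a, b, c, d) = a ^ i * b ^ j * c ^ k * d ^ l"

fun wt :: "nat quad \<Rightarrow> nat quad \<Rightarrow> nat" where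
  "wt (p, q, r, s) (i, j, k, l) = p * i + q * j + r * k + s * l"

lemma mon_add: "mon (m + n) x = mon m x * mon n x"
  by (cases m; cases n; cases x) (simp add: power_add)

lemma wt_add: "wt w (m + n) = wt w m + wt w n"
  by (cases m; cases n; cases w) (simp add: algebra_simps)

type_synonym rule = "nat quad \<times> (complex \<times> nat quad) list"

lemma separating_monomial:
  assumes "x \<noteq> y"
  obtains u where "mon u x \<noteq> mon u y"
proof -
  have "\<exists>u. mon u x \<noteq> mon u y"
  proof (rule ccontr)
    assume "\<nexists>u. mon u x \<noteq> mon u y"
    then have "mon (1, 0, 0, 0) x = mon (1, 0, 0, 0) y" "mon (0, 1, 0, 0) x = mon (0, 1, 0, 0) y"
      "mon (0, 0, 1, 0) x = mon (0, 0, 1, 0) y" "mon (0, 0, 0, 1) x = mon (0, 0, 0, 1) y"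
      by auto
    then show False
      using assms by (cases x; cases y) auto
  qed
  then show ?thesis
    using that by blast
qed

text \<open>Lagrange interpolation in terms of weights: multiplying \<open>l\<close> by a function
  that vanishes at a further point, but not at \<open>x0\<close>, keeps all monomial sums zero. Once
  only \<open>x0\<close> survives, the sum for the monomial 1 is a nonzero multiple of
  \<open>l x0\<close>.\<close>

lemma monomials_determine_weights:
  fixes l :: "complex quad \<Rightarrow> complex"
  assumes S: "finite S" and l: "\<And>m. (\<Sum>x \<in> S. l x * mon m x) = 0" and x0: "x0 \<in> S"
  shows "l x0 = 0"
proof -
  have "\<exists>g. (\<forall>y \<in> T. g y = 0) \<and> g x0 \<noteq> 0 \<and> (\<forall>m. (\<Sum>x \<in> S. l x * g x * mon m x) = 0)"
    if "T \<subseteq> S - {x0}" "finite T" for T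
    using that(2,1)
  proof (induction T rule: finite_induct)
    case empty
    then show ?case
      using l by (intro exI[of _ "\<lambda>_. 1"]) simp
  next
    case (insert y T)
    then obtain g where g: "\<forall>y \<in> T. g y = 0" "g x0 \<noteq> 0"
        "\<And>m. (\<Sum>x \<in> S. l x * g x * mon m x) = 0"
      by auto
    have "x0 \<noteq> y"
      using insert.prems by auto
    then obtain u where u: "mon u x0 \<noteq> mon u y"
      by (rule separating_monomial)
    \<comment> \<open>A new factor vanishing at \<open>y\<close> but not at \<open>x0\<close>.
      Multiplying by \<open>mon u\<close> only shifts exponents, so the annihilation of all
      monomials is preserved.\<close>
    define g' where "g' x = g x * (mon u x - mon u y)" for x
    have "(\<Sum>x \<in> S. l x * g' x * mon m x) = 0" for m
    proof -
      have "(\<Sum>x \<in> S. l x * g' x * mon m x) =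
          (\<Sum>x \<in> S. l x * g x * mon (u + m) x - mon u y * (l x * g x * mon m x))"
        by (intro sum.cong) (simp_all add: g'_def mon_add algebra_simps)
      also have "\<dots> = 0"
        by (simp add: sum_subtractf g(3) flip: sum_distrib_left)
      finally show ?thesis .
    qed
    then show ?case
      using g u by (intro exI[of _ g']) (auto simp: g'_def)
  qed
  from this[of "S - {x0}"] obtain g where g: "\<forall>y \<in> S - {x0}. g y = 0" "g x0 \<noteq> 0"
      "\<And>m. (\<Sum>x \<in> S. l x * g x * mon m x) = 0"
    using S by auto
  have one: "mon (0, 0, 0, 0) x = 1" for x
    by (cases x) simp
  have "0 = (\<Sum>x \<in> S. l x * g x)"
    using g(3)[of "(0, 0, 0, 0)"] by (simp add: one)
  also have "\<dots> = l x0 * g x0 + (\<Sum>x \<in> S - {x0}. l x * g x)"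
    using S x0 by (rule sum.remove)
  also have "(\<Sum>x \<in> S - {x0}. l x * g x) = 0"
    using g(1) by (intro sum.neutral) auto
  finally show ?thesis
    using g(2) by simp
qed

definition rule_holds :: "complex quad set \<Rightarrow> rule \<Rightarrow> bool" where
  "rule_holds S \<rho> \<longleftrightarrow> (\<forall>x \<in> S. mon (fst \<rho>) x = (\<Sum>(c, \<beta>) \<leftarrow> snd \<rho>. c * mon \<beta> x))"

text \<open>A numerical weight plays the part of a monomial order: rewriting terminates by induction
  on a natural number.\<close>

definition rule_decreasing :: "nat quad \<Rightarrow> rule \<Rightarrow> bool" where
  "rule_decreasing w \<rho> \<longleftrightarrow> (\<forall>(c, \<beta>) \<in> set (snd \<rho>). wt w \<beta> < wt w (fst \<rho>))"

text \<open>With more points than normal monomials there is a nonzero weighting of the points annihilating all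
normal monomials, hence, by rewriting, all monomials, which is impossible by interpolation.\<close>

lemma card_le_normal_monomials:
  assumes S: "finite S" and B: "finite B"
    and rules: "\<And>\<rho>. \<rho> \<in> R \<Longrightarrow> rule_holds S \<rho> \<and> rule_decreasing w \<rho>"
    and normal: "\<And>m. m \<notin> B \<Longrightarrow> \<exists>\<rho> \<in> R. \<exists>\<mu>. m = fst \<rho> + \<mu>"
  shows "card S \<le> card B"
proof (rule ccontr)
  assume "\<not> card S \<le> card B"
  then obtain l where l: "\<exists>x \<in> S. l x \<noteq> 0" "\<forall>m \<in> B. (\<Sum>x \<in> S. l x * mon m x) = 0"
    using nontrivial_homogeneous_solution[OF B S] by (metis not_le)
  have "(\<Sum>x \<in> S. l x * mon m x) = 0" for m
  proof (induction m rule: measure_induct_rule[where f = "wt w"])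
    case (less m)
    show ?case
    proof (cases "m \<in> B")
      case False
      then obtain \<alpha> t \<mu> where r: "(\<alpha>, t) \<in> R" "m = \<alpha> + \<mu>"
        using normal by fastforce
      have "(\<Sum>x \<in> S. l x * mon m x) = (\<Sum>x \<in> S. \<Sum>(c, \<beta>) \<leftarrow> t. c * (l x * mon (\<beta> + \<mu>) x))"
        using rules[OF r(1)]
        by (intro sum.cong) (auto simp: r(2) rule_holds_def mon_add case_prod_unfold
          sum_list_mult_const[symmetric] sum_list_const_mult[symmetric] algebra_simps)
      also have "\<dots> = (\<Sum>(c, \<beta>) \<leftarrow> t. c * (\<Sum>x \<in> S. l x * mon (\<beta> + \<mu>) x))"
        by (induction t) (auto simp: sum.distrib sum_distrib_left)
      also have "\<dots> = (\<Sum>p \<leftarrow> t. 0)"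
      proof (intro arg_cong[where f = sum_list] map_cong refl, clarify)
        fix c \<beta> assume "(c, \<beta>) \<in> set t"
        then have "wt w \<beta> < wt w \<alpha>"
          using rules[OF r(1)] by (auto simp: rule_decreasing_def)
        then show "c * (\<Sum>x \<in> S. l x * mon (\<beta> + \<mu>) x) = 0"
          using less.IH[of "\<beta> + \<mu>"] by (simp add: r(2) wt_add)
      qed
      finally show ?thesis
        by simp
    qed (use l in blast)
  qed
  then show False
    using monomials_determine_weights[OF S] l(1) by metis
qed

section \<open>Ulam polynomials as lists of roots\<close>

text \<open>Raising \<open>N\<close> by one multiplies by \<open>x\<close> and supplies a new
  constant term; \<open>Poly\<close> lists coefficients from the constant term upwards, whence
  \<open>rev\<close>.\<close>

lemma monom_sum_eq_Poly:
  fixes \<gamma> :: "nat \<Rightarrow> 'a :: comm_semiring_1"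
  shows
  "monom 1 N + (\<Sum>m = 1..N. monom (\<gamma> m) (N - m)) = Poly (rev (1 # map \<gamma> [1..<Suc N]))"
proof (induction N)
  case 0
  then show ?case
    by (simp add: monom_0)
next
  case (Suc N)
  have shift: "(\<Sum>m = 1..N. monom (\<gamma> m) (Suc N - m)) = pCons 0 (\<Sum>m = 1..N. monom (\<gamma> m) (N - m))"
  proof -
    have pCons_0: "pCons 0 q = monom 1 1 * q" for q :: "'a poly"
      by (simp add: monom_Suc)
    show ?thesis
      unfolding pCons_0 sum_distrib_left
      by (intro sum.cong refl) (simp add: mult_monom Suc_diff_le)
  qed
  have "monom 1 (Suc N) + (\<Sum>m = 1..Suc N. monom (\<gamma> m) (Suc N - m))
      = pCons (\<gamma> (Suc N)) (monom 1 N + (\<Sum>m = 1..N. monom (\<gamma> m) (N - m)))"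
    using shift by (simp add: monom_Suc monom_0)
  then show ?case
    unfolding Suc by (simp add: upt_Suc_append del: upt_Suc)
qed

lemma mem_ulam_polys_iff:
  assumes "N \<ge> 1"
  shows "p \<in> ulam_polys N \<longleftrightarrow>
    (\<exists>xs. length xs = N \<and> p = Poly (rev (1 # xs)) \<and> p = (\<Prod>x \<leftarrow> xs. [:- x, 1:]))"
proof -
  have prod: "(\<Prod>n = 1..N. [:- \<gamma> n, 1:]) = (\<Prod>x \<leftarrow> map \<gamma> [1..<Suc N]. [:- x, 1:])" for \<gamma> :: "nat \<Rightarrow> complex"
    by (simp add: prod.distinct_set_conv_list[symmetric] o_def atLeastLessThanSuc_atLeastAtMost del: upt_Suc)
  show ?thesis
  proof
    assume "p \<in> ulam_polys N"
    then obtain \<gamma> where "p = Poly (rev (1 # map \<gamma> [1..<Suc N]))"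
        "p = (\<Prod>x \<leftarrow> map \<gamma> [1..<Suc N]. [:- x, 1:])"
      unfolding ulam_polys_def is_ulam_poly_def monom_sum_eq_Poly prod by blast
    then show "\<exists>xs. length xs = N \<and> p = Poly (rev (1 # xs)) \<and> p = (\<Prod>x \<leftarrow> xs. [:- x, 1:])"
      by (intro exI[of _ "map \<gamma> [1..<Suc N]"]) (simp del: upt_Suc)
  next
    assume "\<exists>xs. length xs = N \<and> p = Poly (rev (1 # xs)) \<and> p = (\<Prod>x \<leftarrow> xs. [:- x, 1:])"
    then obtain xs where xs: "length xs = N" "p = Poly (rev (1 # xs))" "p = (\<Prod>x \<leftarrow> xs. [:- x, 1:])"
      by blast
    \<comment> \<open>The sequence is indexed from 1, the list from 0.\<close>
    define \<gamma> where "\<gamma> n = xs ! (n - 1)" for n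
    have "map \<gamma> [1..<Suc N] = xs"
      using xs(1) by (intro nth_equalityI) (simp_all add: \<gamma>_def del: upt_Suc)
    then show "p \<in> ulam_polys N"
      unfolding ulam_polys_def is_ulam_poly_def monom_sum_eq_Poly prod mem_Collect_eq
      using xs assms by metis
  qed
qed

lemma ulam_polys_Suc_zero:
  assumes "N \<ge> 1"
  shows "{p \<in> ulam_polys (Suc N). coeff p 0 = 0} = pCons 0 ` ulam_polys N"
proof (intro equalityI subsetI)
  fix p assume "p \<in> {p \<in> ulam_polys (Suc N). coeff p 0 = 0}"
  then have "p \<in> ulam_polys (Suc N)" and 0: "coeff p 0 = 0"
    by auto
  then obtain xs where xs: "length xs = Suc N" "p = Poly (rev (1 # xs))" "p = (\<Prod>x \<leftarrow> xs. [:- x, 1:])"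
    using mem_ulam_polys_iff[of "Suc N" p] by auto
  obtain ys y where ys: "xs = ys @ [y]"
    using xs(1) by (cases xs rule: rev_cases) auto
  have "y = 0"
    using 0 xs(2) by (simp add: ys)
  then have "p = pCons 0 (Poly (rev (1 # ys)))" "p = pCons 0 (\<Prod>x \<leftarrow> ys. [:- x, 1:])"
    using xs(2,3) by (simp_all add: ys)
  then show "p \<in> pCons 0 ` ulam_polys N"
    using xs(1) ys assms mem_ulam_polys_iff[of N "Poly (rev (1 # ys))"] by (intro image_eqI[of _ _ "Poly (rev (1 # ys))"]) auto
next
  fix p assume "p \<in> pCons 0 ` ulam_polys N"
  then obtain ys where ys: "length ys = N" "p = pCons 0 (Poly (rev (1 # ys)))"
      "p = pCons 0 (\<Prod>x \<leftarrow> ys. [:- x, 1:])"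
    using assms by (auto simp: mem_ulam_polys_iff)
  then show "p \<in> {p \<in> ulam_polys (Suc N). coeff p 0 = 0}"
    by (auto simp: mem_ulam_polys_iff intro!: exI[of _ "ys @ [0]"])
qed

lemma card_ulam_polys_Suc:
  assumes "N \<ge> 1" "finite (ulam_polys N)" "finite {p \<in> ulam_polys (Suc N). coeff p 0 \<noteq> 0}"
  shows "finite (ulam_polys (Suc N)) \<and>
    card (ulam_polys (Suc N)) = card (ulam_polys N) + card {p \<in> ulam_polys (Suc N). coeff p 0 \<noteq> 0}"
proof -
  let ?Z = "{p \<in> ulam_polys (Suc N). coeff p 0 = 0}" and ?P = "{p \<in> ulam_polys (Suc N). coeff p 0 \<noteq> 0}"
  have "inj_on (pCons 0) (ulam_polys N)"
    by (auto intro: inj_onI)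
  then have "finite ?Z" "card ?Z = card (ulam_polys N)"
    using assms by (simp_all add: ulam_polys_Suc_zero card_image)
  moreover have "?Z \<inter> ?P = {}"
    by auto
  ultimately have "finite (?Z \<union> ?P) \<and> card (?Z \<union> ?P) = card (ulam_polys N) + card ?P"
    using assms(3) by (simp add: card_Un_disjoint)
  moreover have "?Z \<union> ?P = ulam_polys (Suc N)"
    by auto
  ultimately show ?thesis
    by simp
qed

section \<open>Explicit descriptions in degrees 1 to 5\<close>

lemma ulam_polys_1: "ulam_polys 1 = {[:0, 1:]}"
proof -
  have "p \<in> ulam_polys 1 \<longleftrightarrow> (\<exists>a. p = [:a, 1:] \<and> [:a, 1:] = [:- a, 1:])" for p
    by (auto simp: mem_ulam_polys_iff length_Suc_conv)
  then show ?thesis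
    by (auto simp: set_eq_iff)
qed

lemma ex_length_Suc: "(\<exists>xs. length xs = Suc n \<and> P xs) \<longleftrightarrow> (\<exists>x xs. length xs = n \<and> P (x # xs))"
  by (auto simp: length_Suc_conv)

lemma mem_ulam_polys_2:
  "p \<in> ulam_polys 2 \<longleftrightarrow> (\<exists>a b. p = [:b, a, 1:] \<and> p = [:- a, 1:] * [:- b, 1:])"
  using mem_ulam_polys_iff[of "Suc (Suc 0)" p]
  by (simp only: ex_length_Suc length_0_conv) (simp add: numeral_eq_Suc del: mult_pCons_left mult_pCons_right)

lemma mem_ulam_polys_3:
  "p \<in> ulam_polys 3 \<longleftrightarrow> (\<exists>a b c. p = [:c, b, a, 1:] \<and> p = [:- a, 1:] * ([:- b, 1:] * [:- c, 1:]))"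
  using mem_ulam_polys_iff[of "Suc (Suc (Suc 0))" p]
  by (simp only: ex_length_Suc length_0_conv) (simp add: numeral_eq_Suc del: mult_pCons_left mult_pCons_right)

lemma mem_ulam_polys_4:
  "p \<in> ulam_polys 4 \<longleftrightarrow> (\<exists>a b c d. p = [:d, c, b, a, 1:] \<and>
     p = [:- a, 1:] * ([:- b, 1:] * ([:- c, 1:] * [:- d, 1:])))"
  using mem_ulam_polys_iff[of "Suc (Suc (Suc (Suc 0)))" p]
  by (simp only: ex_length_Suc length_0_conv) (simp add: numeral_eq_Suc del: mult_pCons_left mult_pCons_right)

lemma mem_ulam_polys_5:
  "p \<in> ulam_polys 5 \<longleftrightarrow> (\<exists>a b c d e. p = [:e, d, c, b, a, 1:] \<and>
     p = [:- a, 1:] * ([:- b, 1:] * ([:- c, 1:] * ([:- d, 1:] * [:- e, 1:]))))"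
  using mem_ulam_polys_iff[of "Suc (Suc (Suc (Suc (Suc 0))))" p]
  by (simp only: ex_length_Suc length_0_conv) (simp add: numeral_eq_Suc del: mult_pCons_left mult_pCons_right)

section \<open>The reduced systems\<close>

text \<open>In all three systems \<open>s\<close> is a homogenising variable: the zeros for \<open>s = 10 ^ 6\<close> are \<open>10 ^ 6\<close> times
those for \<open>s = 1\<close>, so decimal approximations become Gaussian integers. The first equation
eliminates the last coefficient \<open>e\<close>, and the factor \<open>e\<close> has been cancelled from the last equation
\<open>e = - a b c d e\<close>; the resulting \<open>a b c d = - 1\<close> also simplifies the fourth equation.\<close>

fun sys5 :: "int \<Rightarrow> complex quad \<Rightarrow> complex quad" where
  "sys5 s (a, b, c, d) =
     (let e = linear_form ((-2, 0), (-1, 0), (-1, 0), (-1, 0)) (a, b, c, d);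
          p = a + b; q = c + d; ab = a * b; cd = c * d;
          e2 = ab + (cd + p * q); e3 = ab * q + cd * p
      in (e2 + e * (p + q) + of_int (- s) * b,
          e3 + e * e2 + of_int (s ^ 2) * c,
          e * e3 + of_int (- (s ^ 3)) * d + gval (- (s ^ 4), 0),
          ab * cd + gval (s ^ 4, 0)))"

text \<open>The bracketing copies \<open>sys5\<close> operation by operation, so that the enclosure
  follows from the structure of the term alone.\<close>

fun tsys5 :: "int \<Rightarrow> tmodel quad \<Rightarrow> tmodel quad" where
  "tsys5 s (a, b, c, d) =
     (let e = tlinear_form ((-2, 0), (-1, 0), (-1, 0), (-1, 0)) (a, b, c, d);
          p = tadd a b; q = tadd c d; ab = tmul a b; cd = tmul c d;
          e2 = tadd ab (tadd cd (tmul p q)); e3 = tadd (tmul ab q) (tmul cd p)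
      in (tadd (tadd e2 (tmul e (tadd p q))) (tscale (- s) b),
          tadd (tadd e3 (tmul e e2)) (tscale (s ^ 2) c),
          tadd (tadd (tmul e e3) (tscale (- (s ^ 3)) d)) (tconst (- (s ^ 4), 0)),
          tadd (tmul ab cd) (tconst (s ^ 4, 0))))"

lemma encloses_sys5: "encloses (sys5 s) (tsys5 s)"
  unfolding encloses_def
  by (auto simp: Let_def split_paired_all simp del: linear_form.simps tlinear_form.simps gval.simps
      of_int_minus of_int_power intro!: encl_tconst encl_tadd encl_tmul encl_tscale encl_linear_form)

lemma continuous_on_sys5: "continuous_on S (sys5 s)"
proof -
  have "sys5 s = (\<lambda>x. sys5 s (fst x, fst (snd x), fst (snd (snd x)), snd (snd (snd x))))"
    by simp
  then show ?thesis
    by (rule ssubst) (simp only: sys5.simps linear_form.simps Let_def, intro continuous_intros)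
qed

fun sys4 :: "int \<Rightarrow> complex quad \<Rightarrow> complex quad" where
  "sys4 s (a, b, c, d) =
     (let p = a + b; ab = a * b; e2 = ab + p * c; e3 = ab * c
      in (linear_form ((2, 0), (1, 0), (1, 0), (1, 0)) (a, b, c, d),
          e2 + d * (p + c) + of_int (- s) * b,
          e3 + d * e2 + of_int (s ^ 2) * c,
          e3 + gval (- (s ^ 3), 0)))"

fun tsys4 :: "int \<Rightarrow> tmodel quad \<Rightarrow> tmodel quad" where
  "tsys4 s (a, b, c, d) =
     (let p = tadd a b; ab = tmul a b; e2 = tadd ab (tmul p c); e3 = tmul ab c
      in (tlinear_form ((2, 0), (1, 0), (1, 0), (1, 0)) (a, b, c, d),
          tadd (tadd e2 (tmul d (tadd p c))) (tscale (- s) b),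
          tadd (tadd e3 (tmul d e2)) (tscale (s ^ 2) c),
          tadd e3 (tconst (- (s ^ 3), 0))))"

text \<open>The fourth coordinate is a dummy; it lets all three systems share the four-variable machinery.\<close>

fun sys3 :: "int \<Rightarrow> complex quad \<Rightarrow> complex quad" where
  "sys3 s (a, b, c, d) =
     (linear_form ((2, 0), (1, 0), (1, 0), (0, 0)) (a, b, c, d),
      a * b + (a + b) * c + of_int (- s) * b,
      a * b + gval (s ^ 2, 0),
      d)"

fun tsys3 :: "int \<Rightarrow> tmodel quad \<Rightarrow> tmodel quad" where
  "tsys3 s (a, b, c, d) =
     (tlinear_form ((2, 0), (1, 0), (1, 0), (0, 0)) (a, b, c, d),
      tadd (tadd (tmul a b) (tmul (tadd a b) c)) (tscale (- s) b),
      tadd (tmul a b) (tconst (s ^ 2, 0)),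
      d)"

lemma encloses_sys4: "encloses (sys4 s) (tsys4 s)"
  unfolding encloses_def
  by (auto simp: Let_def split_paired_all simp del: linear_form.simps tlinear_form.simps gval.simps
      of_int_minus of_int_power intro!: encl_tconst encl_tadd encl_tmul encl_tscale encl_linear_form)

lemma encloses_sys3: "encloses (sys3 s) (tsys3 s)"
  unfolding encloses_def
  by (auto simp: Let_def split_paired_all simp del: linear_form.simps tlinear_form.simps gval.simps
      of_int_minus of_int_power intro!: encl_tconst encl_tadd encl_tmul encl_tscale encl_linear_form)

lemma continuous_on_sys4: "continuous_on S (sys4 s)"
proof -
  have "sys4 s = (\<lambda>x. sys4 s (fst x, fst (snd x), fst (snd (snd x)), snd (snd (snd x))))"
    by simp
  then show ?thesis
    by (rule ssubst) (simp only: sys4.simps linear_form.simps Let_def, intro continuous_intros)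
qed

lemma continuous_on_sys3: "continuous_on S (sys3 s)"
proof -
  have "sys3 s = (\<lambda>x. sys3 s (fst x, fst (snd x), fst (snd (snd x)), snd (snd (snd x))))"
    by simp
  then show ?thesis
    by (rule ssubst) (simp only: sys3.simps linear_form.simps, intro continuous_intros)
qed

section \<open>Homogeneity and change of scale\<close>

lemma linear_form_scale: "linear_form K (map_quad ((*) z) x) = z * linear_form K x"
  by (cases x; cases K) (simp add: algebra_simps del: gval.simps)

lemma sys5_scale:
  assumes "s \<noteq> 0"
  shows "sys5 s (map_quad ((*) (of_int s)) x) = (0, 0, 0, 0) \<longleftrightarrow> sys5 1 x = (0, 0, 0, 0)"
proof -
  obtain a b c d where x: "x = (a, b, c, d)"
    by (metis prod_cases4)
  let ?s = "of_int s :: complex"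
  obtain f g h k where f: "sys5 1 x = (f, g, h, k)"
    by (metis prod_cases4)
  \<comment> \<open>The exponents are the degrees of the four equations when \<open>s\<close> counts
    as a variable.\<close>
  have "sys5 s (map_quad ((*) ?s) x) = (?s ^ 2 * f, ?s ^ 3 * g, ?s ^ 4 * h, ?s ^ 4 * k)"
    using f by (simp add: x Let_def gval_of_int del: gval.simps) (auto; simp add: eval_nat_numeral algebra_simps)
  then show ?thesis
    using assms by (simp add: f)
qed

lemma sys4_scale:
  assumes "s \<noteq> 0"
  shows "sys4 s (map_quad ((*) (of_int s)) x) = (0, 0, 0, 0) \<longleftrightarrow> sys4 1 x = (0, 0, 0, 0)"
proof -
  obtain a b c d where x: "x = (a, b, c, d)"
    by (metis prod_cases4)
  let ?s = "of_int s :: complex"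
  obtain f g h k where f: "sys4 1 x = (f, g, h, k)"
    by (metis prod_cases4)
  have "sys4 s (map_quad ((*) ?s) x) = (?s * f, ?s ^ 2 * g, ?s ^ 3 * h, ?s ^ 3 * k)"
    using f by (simp add: x Let_def gval_of_int del: gval.simps) (auto; simp add: eval_nat_numeral algebra_simps)
  then show ?thesis
    using assms by (simp add: f)
qed

lemma sys3_scale:
  assumes "s \<noteq> 0"
  shows "sys3 s (map_quad ((*) (of_int s)) x) = (0, 0, 0, 0) \<longleftrightarrow> sys3 1 x = (0, 0, 0, 0)"
proof -
  obtain a b c d where x: "x = (a, b, c, d)"
    by (metis prod_cases4)
  let ?s = "of_int s :: complex"
  obtain f g h k where f: "sys3 1 x = (f, g, h, k)"
    by (metis prod_cases4)
  have "sys3 s (map_quad ((*) ?s) x) = (?s * f, ?s ^ 2 * g, ?s ^ 2 * h, ?s * k)"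
    using f by (simp add: x gval_of_int del: gval.simps) (auto; simp add: eval_nat_numeral algebra_simps)
  then show ?thesis
    using assms by (simp add: f)
qed

lemma bij_betw_zeros_scale:
  assumes s: "s \<noteq> 0"
    and scale: "\<And>x. f s (map_quad ((*) (of_int s)) x) = (0, 0, 0, 0) \<longleftrightarrow> f 1 x = (0, 0, 0, 0)"
  shows "bij_betw (map_quad ((*) (of_int s)))
    {x. f (1::int) x = (0, 0, 0, 0) \<and> linear_form M x \<noteq> 0}
    {x. f s x = (0, 0, 0, 0) \<and> linear_form M x \<noteq> 0}"
proof -
  let ?m = "map_quad ((*) (of_int s)) :: complex quad \<Rightarrow> _"
  have inv: "?m (map_quad (\<lambda>z. z / of_int s) x) = x" "map_quad (\<lambda>z. z / of_int s) (?m x) = x" for x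
    using s by (cases x; simp)+
  have "f 1 (map_quad (\<lambda>z. z / of_int s) y) = (0, 0, 0, 0) \<longleftrightarrow> f s y = (0, 0, 0, 0)"
    "linear_form M (map_quad (\<lambda>z. z / of_int s) y) \<noteq> 0 \<longleftrightarrow> linear_form M y \<noteq> 0" for y
    using scale[of "map_quad (\<lambda>z. z / of_int s) y"] s
      linear_form_scale[of M "of_int s" "map_quad (\<lambda>z. z / of_int s) y"] by (simp_all add: inv)
  then show ?thesis
    using s scale
    by (intro bij_betwI[where g = "map_quad (\<lambda>z. z / of_int s)"]) (auto simp: inv linear_form_scale)
qed

text \<open>The factored form of \<open>sys5\<close> is short to evaluate; this is its translation
  into elementary symmetric polynomials, as they appear when the product of linear factors is
  expanded.\<close>

lemma sys5_zero_iff: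
  "sys5 1 (a, b, c, d) = (0, 0, 0, 0) \<and> e = linear_form ((-2, 0), (-1, 0), (-1, 0), (-1, 0)) (a, b, c, d) \<longleftrightarrow>
     e = - (2 * a + b + c + d) \<and>
     b = a * b + a * c + a * d + a * e + b * c + b * d + b * e + c * d + c * e + d * e \<and>
     c = - (a*b*c + a*b*d + a*b*e + a*c*d + a*c*e + a*d*e + b*c*d + b*c*e + b*d*e + c*d*e) \<and>
     d = a*b*c*d + a*b*c*e + a*b*d*e + a*c*d*e + b*c*d*e \<and>
     a * b * c * d = - 1"
  (is "?L \<and> e = ?e \<longleftrightarrow> ?e' \<and> ?R")
proof -
  have "e = ?e \<longleftrightarrow> ?e'"
    by (simp add: gval_of_int algebra_simps del: gval.simps)
  moreover have "?L \<longleftrightarrow> ?R" if "e = ?e"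
  proof -
    have 1: "?L \<longleftrightarrow> a * b + (c * d + (a + b) * (c + d)) + e * (a + b + (c + d)) - b = 0 \<and>
        a * b * (c + d) + c * d * (a + b) + e * (a * b + (c * d + (a + b) * (c + d))) + c = 0 \<and>
        e * (a * b * (c + d) + c * d * (a + b)) - d - 1 = 0 \<and> a * b * (c * d) + 1 = 0"
      by (simp add: Let_def gval_of_int that del: gval.simps)
    show ?thesis
      unfolding 1 by (intro iffI; elim conjE; intro conjI; algebra)
  qed
  ultimately show ?thesis
    by blast
qed

lemma sys4_zero_iff:
  "sys4 1 (a, b, c, d) = (0, 0, 0, 0) \<longleftrightarrow>
     d = - (2 * a + b + c) \<and>
     b = a * b + a * c + a * d + b * c + b * d + c * d \<and>
     c = - (a * b * c + a * b * d + a * c * d + b * c * d) \<and>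
     a * b * c = 1"
proof -
  have 1: "sys4 1 (a, b, c, d) = (0, 0, 0, 0) \<longleftrightarrow> 2 * a + b + (c + d) = 0 \<and>
      a * b + (a + b) * c + d * (a + b + c) - b = 0 \<and>
      a * b * c + d * (a * b + (a + b) * c) + c = 0 \<and> a * b * c - 1 = 0"
    by (simp add: Let_def gval_of_int del: gval.simps)
  show ?thesis
    unfolding 1 by (intro iffI; elim conjE; intro conjI; algebra)
qed

lemma sys3_zero_iff:
  "sys3 1 (a, b, c, d) = (0, 0, 0, 0) \<longleftrightarrow>
     c = - (2 * a + b) \<and> b = a * b + a * c + b * c \<and> a * b = - 1 \<and> d = 0"
proof -
  have 1: "sys3 1 (a, b, c, d) = (0, 0, 0, 0) \<longleftrightarrow> 2 * a + b + c = 0 \<and>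
      a * b + (a + b) * c - b = 0 \<and> a * b + 1 = 0 \<and> d = 0"
    by (simp add: gval_of_int del: gval.simps)
  show ?thesis
    unfolding 1 by (intro iffI; elim conjE; intro conjI; (assumption | algebra))
qed

section \<open>Upper bounds\<close>

definition zeros5 :: "complex quad set" where
  "zeros5 = {x. sys5 1 x = (0, 0, 0, 0)}"
definition zeros4 :: "complex quad set" where
  "zeros4 = {x. sys4 1 x = (0, 0, 0, 0)}"
definition zeros3 :: "complex quad set" where
  "zeros3 = {x. sys3 1 x = (0, 0, 0, 0)}"

abbreviation last5 :: "gint quad" where
  "last5 \<equiv> ((-2, 0), (-1, 0), (-1, 0), (-1, 0))"
abbreviation last4 :: "gint quad" where
  "last4 \<equiv> ((0, 0), (0, 0), (0, 0), (1, 0))"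
abbreviation last3 :: "gint quad" where
  "last3 \<equiv> ((0, 0), (0, 0), (1, 0), (0, 0))"

text \<open>The variables are ordered with the last coefficient first, i.e. \<open>(e, a, b, c)\<close> in degree 5. The
polynomial \<open>P\<close> vanishes at its own coefficients, and the rules are, in order, its divided differences
\<open>P[e,a,b,c]\<close> and \<open>P[e,a,b]\<close>, then \<open>P[e] / e\<close>, \<open>P[e,a] - P[e] / e\<close> and \<open>P[a]\<close>, solved for the monomial of largest
weight. The leading forms are a complete intersection, so the staircase has
\<open>2 * 3 * 16 = 96\<close> monomials.\<close>

definition rules5 :: "rule set" where
  "rules5 =
    {((0,0,0,2), [(-1,(2,0,0,0)), (-2,(0,2,0,0)), (-1,(0,0,2,0)), (-2,(1,1,0,0)), (-1,(1,0,1,0)),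
        (-1,(1,0,0,1)), (-2,(0,1,1,0)), (-2,(0,1,0,1)), (-1,(0,0,1,1)), (-1,(0,0,1,0))]),
     ((0,0,3,0), [(-1,(3,0,0,0)), (-2,(0,3,0,0)), (-2,(2,1,0,0)), (-1,(2,0,1,0)), (-2,(1,2,0,0)),
        (-2,(0,2,1,0)), (-1,(1,0,2,0)), (-2,(0,1,2,0)), (-2,(1,1,1,0)), (-1,(1,0,1,0)),
        (-1,(0,1,1,0)), (-1,(0,0,2,0)), (-1,(0,0,0,1))]),
     ((4,0,0,0), [(-1,(3,1,0,0)), (-1,(2,0,1,0)), (-1,(1,0,0,1)), (2,(0,1,0,0)), (1,(0,0,1,0)),
        (1,(0,0,0,1)), (1,(1,0,0,0)), (-1,(0,0,0,0))]),
     ((3,1,0,0), [(-2,(2,2,0,0)), (-2,(1,3,0,0)), (-2,(0,4,0,0)), (-1,(1,1,1,0)), (-1,(0,2,1,0)),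
        (-1,(0,1,0,1)), (1,(0,0,0,0))]),
     ((0,5,0,0), [(-1/2,(0,3,1,0)), (-1/2,(0,2,0,1)), (1,(0,2,0,0)), (1/2,(0,1,1,0)),
        (1/2,(0,1,0,1)), (1/2,(1,1,0,0)), (-1/2,(1,0,0,0))])}"

text \<open>The divided differences of the quartic, in the variables \<open>(d, a, b, c)\<close>. No
  variable has been eliminated, so the linear equation is itself the first rule, with lead
  \<open>c\<close>.\<close>

definition rules4 :: "rule set" where
  "rules4 =
    {((0,0,0,1), [(-2,(0,1,0,0)), (-1,(0,0,1,0)), (-1,(1,0,0,0))]),
     ((0,0,2,0), [(-1,(2,0,0,0)), (-2,(0,2,0,0)), (-2,(1,1,0,0)), (-1,(1,0,1,0)), (-2,(0,1,1,0)),
        (-1,(0,0,1,0))]),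
     ((3,0,0,0), [(-1,(2,1,0,0)), (-1,(1,0,1,0)), (-1,(0,0,0,1)), (-1,(0,0,0,0))]),
     ((2,1,0,0), [(-2,(1,2,0,0)), (-2,(0,3,0,0)), (-1,(0,1,1,0)), (1,(0,0,0,0))]),
     ((0,4,0,0), [(-1/2,(0,2,1,0)), (-1/2,(0,1,0,1)), (-1/2,(1,0,0,0))])}"

text \<open>Here the variables are \<open>(c, a, b, d)\<close>; the rule with empty right-hand side
  says that the dummy \<open>d\<close> is 0.\<close>

definition rules3 :: "rule set" where
  "rules3 =
    {((0,0,0,1), []),
     ((0,0,1,0), [(-2,(0,1,0,0)), (-1,(1,0,0,0))]),
     ((2,0,0,0), [(-1,(1,1,0,0)), (-1,(0,0,1,0)), (-1,(0,0,0,0))]),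
     ((1,1,0,0), [(-2,(0,2,0,0)), (1,(0,0,0,0))]),
     ((0,3,0,0), [(-1/2,(0,1,1,0)), (-1/2,(1,0,0,0))])}"

text \<open>The exponents above none of the five corners in \<open>not_in_staircase\<close>. Two
  corners have degree \<open>p + 1\<close> in the first two variables, which leaves the single pair
  \<open>(p, 0)\<close> outside the rectangle. In the three uses \<open>q = p + 2\<close>, so the
  first two variables contribute \<open>(p + 1) ^ 2\<close>, the Bezout number of two forms of
  degree \<open>p + 1\<close>.\<close>

definition staircase :: "nat \<Rightarrow> nat \<Rightarrow> nat \<Rightarrow> nat \<Rightarrow> nat quad set" where
  "staircase p q r s = {(i, j, k, l). (i < p \<and> j < q \<or> i = p \<and> j = 0) \<and> k < r \<and> l < s}"

lemma card_staircase: "finite (staircase p q r s) \<and> card (staircase p q r s) = (p * q + 1) * r * s"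
proof -
  define f :: "(nat \<times> nat) \<times> nat \<times> nat \<Rightarrow> nat quad" where "f = (\<lambda>((i, j), k, l). (i, j, k, l))"
  let ?A = "insert (p, 0) ({..<p} \<times> {..<q}) \<times> {..<r} \<times> {..<s}"
  have "staircase p q r s = f ` ?A"
    by (force simp: staircase_def f_def)
  moreover have "inj_on f ?A"
    by (auto simp: inj_on_def f_def)
  ultimately show ?thesis
    by (simp add: card_image card_cartesian_product algebra_simps)
qed

lemma not_in_staircase:
  assumes "m \<notin> staircase p q r s"
  shows "\<exists>\<alpha> \<in> {(p + 1, 0, 0, 0), (p, 1, 0, 0), (0, q, 0, 0), (0, 0, r, 0), (0, 0, 0, s)}. \<exists>\<mu>. m = \<alpha> + \<mu>"
proof -
  obtain i j k l where m: "m = (i, j, k, l)"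
    by (metis prod_cases4)
  have ex: "\<exists>\<mu>. (i, j, k, l) = (i', j', k', l') + \<mu>" if "i' \<le> i" "j' \<le> j" "k' \<le> k" "l' \<le> l" for i' j' k' l'
    using that by (intro exI[of _ "(i - i', j - j', k - k', l - l')"]) simp
  have "p + 1 \<le> i \<or> p \<le> i \<and> 1 \<le> j \<or> q \<le> j \<or> r \<le> k \<or> s \<le> l"
    using assms by (auto simp: staircase_def m)
  then show ?thesis
    unfolding m
    by (elim disjE conjE) (blast intro: ex le0)+
qed

lemma card_le_staircase:
  assumes "finite S"
    and rules: "\<And>\<rho>. \<rho> \<in> R \<Longrightarrow> rule_holds S \<rho> \<and> rule_decreasing w \<rho>"
    and leads: "{(p + 1, 0, 0, 0), (p, 1, 0, 0), (0, q, 0, 0), (0, 0, r, 0), (0, 0, 0, s)} \<subseteq> fst ` R"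
  shows "card S \<le> (p * q + 1) * r * s"
proof -
  have "\<exists>\<rho> \<in> R. \<exists>\<mu>. m = fst \<rho> + \<mu>" if "m \<notin> staircase p q r s" for m
  proof -
    obtain \<alpha> \<mu> where \<alpha>: "\<alpha> \<in> fst ` R" "m = \<alpha> + \<mu>"
      using not_in_staircase[of m p q r s] \<open>m \<notin> staircase p q r s\<close> leads by blast
    then obtain \<rho> where "\<rho> \<in> R" "fst \<rho> = \<alpha>"
      by (metis imageE)
    then show ?thesis
      using \<alpha>(2) by blast
  qed
  then have "card S \<le> card (staircase p q r s)"
    using card_le_normal_monomials[OF \<open>finite S\<close> _ rules] card_staircase by blast
  then show ?thesis
    by (simp add: card_staircase)
qed

text \<open>The interpolation argument concerns finite point sets, while finiteness of the zero set
  is not known beforehand; a uniform bound on finite subsets gives both.\<close>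

lemma finite_card_le_via_inj:
  assumes "inj_on \<phi> Z" "\<And>S. finite S \<Longrightarrow> S \<subseteq> \<phi> ` Z \<Longrightarrow> card S \<le> n"
  shows "finite Z \<and> card Z \<le> n"
proof -
  have "finite (\<phi> ` Z) \<and> card (\<phi> ` Z) \<le> n"
    using assms(2) by (intro finite_if_finite_subsets_card_bdd) auto
  then show ?thesis
    using assms(1) by (simp add: card_image finite_image_iff)
qed

lemma zeros5_bound: "finite zeros5 \<and> card zeros5 \<le> 96"
proof (rule finite_card_le_via_inj)
  \<comment> \<open>The coordinate \<open>d\<close> is traded for \<open>e\<close>; the linear
    equation recovers it, so the map is injective.\<close>
  let ?\<phi> = "\<lambda>(a, b, c, d). (- (2 * a + b + c + d), a, b, c) :: complex quad"
  show "inj_on ?\<phi> zeros5"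
    by (auto simp: inj_on_def)
  fix S assume "finite S" "S \<subseteq> ?\<phi> ` zeros5"
  \<comment> \<open>The weights of \<open>(e, a, b, c)\<close> perturb ten times the total degree
    slightly, with ties resolved in the order \<open>c\<close>, \<open>b\<close>, \<open>e\<close>,
    \<open>a\<close>.\<close>
  have "rule_holds S \<rho> \<and> rule_decreasing (11, 10, 12, 13) \<rho>" if "\<rho> \<in> rules5" for \<rho>
  proof
    show "rule_decreasing (11, 10, 12, 13) \<rho>"
      using that by (auto simp: rules5_def rule_decreasing_def)
    have key: "\<forall>\<rho> \<in> rules5. mon (fst \<rho>) (e, a, b, c) = (\<Sum>(t, \<beta>) \<leftarrow> snd \<rho>. t * mon \<beta> (e, a, b, c))"
      if "sys5 1 (a, b, c, d) = (0, 0, 0, 0)" "e = - (2 * a + b + c + d)" for a b c d e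
    proof -
      have eqs: "d = - (2 * a + b + c + e)"
         "b = a * b + a * c + a * d + a * e + b * c + b * d + b * e + c * d + c * e + d * e"
         "c = - (a*b*c + a*b*d + a*b*e + a*c*d + a*c*e + a*d*e + b*c*d + b*c*e + b*d*e + c*d*e)"
         "d = a*b*c*d + a*b*c*e + a*b*d*e + a*c*d*e + b*c*d*e"
         "a * b * c * d = - 1"
        using that sys5_zero_iff[of a b c d e] by (auto simp: gval_of_int simp del: gval.simps sys5.simps)
      have r1: "c^2 = -(e^2+2*a^2+b^2+2*e*a+e*b+e*c+2*a*b+2*a*c+b*c+b)"
        using eqs(1,2) by algebra
      have r2: "b^3 = -(e^3+2*a^3+2*e^2*a+e^2*b+2*a^2*e+2*a^2*b+b^2*e+2*b^2*a+2*e*a*b+e*b+a*b+b^2+c)"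
        using eqs(1,2,3) by algebra
      have r3: "e^4 = -a*e^3-b*e^2-c*e+2*a+b+c+e-1"
        using eqs by algebra
      have r4: "a*e^3 = -2*a^2*e^2-2*a^3*e-2*a^4-b*e*a-b*a^2-c*a+1"
        using eqs by algebra
      have r5: "2*a^5 = -b*a^3-c*a^2+2*a^2+a*b+a*c+a*e-e"
        using eqs by algebra
      show ?thesis
        unfolding rules5_def
        apply (simp only: ball_simps simp_thms)
        apply (intro conjI)
        subgoal by (simp; use r1 in algebra)
        subgoal by (simp; use r2 in algebra)
        subgoal by (simp; use r3 in algebra)
        subgoal by (simp; use r4 in algebra)
        subgoal by (simp; use r5 in algebra)
        done
    qed
    show "rule_holds S \<rho>"
      unfolding rule_holds_def
    proof
      fix y assume "y \<in> S"
      then obtain a b c d where "sys5 1 (a, b, c, d) = (0, 0, 0, 0)" "y = (- (2 * a + b + c + d), a, b, c)"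
        using \<open>S \<subseteq> ?\<phi> ` zeros5\<close> unfolding zeros5_def by auto
      then show "mon (fst \<rho>) y = (\<Sum>(c, \<beta>) \<leftarrow> snd \<rho>. c * mon \<beta> y)"
        using key \<open>\<rho> \<in> _\<close> by blast
    qed
  qed
  \<comment> \<open>The leads \<open>e^4\<close>, \<open>e^3 * a\<close>, \<open>a^5\<close>,
    \<open>b^3\<close> and \<open>c^2\<close> are the corners for these parameters, and
    \<open>(3 * 5 + 1) * 3 * 2 = 96\<close>.\<close>
  from card_le_staircase[where R = rules5 and p = 3 and q = 5 and r = 3 and s = 2, OF \<open>finite S\<close> this] show "card S \<le> 96"
    by (simp add: rules5_def)
qed

lemma zeros4_bound: "finite zeros4 \<and> card zeros4 \<le> 18"
proof (rule finite_card_le_via_inj)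
  let ?\<phi> = "\<lambda>(a, b, c, d). (d, a, b, c) :: complex quad"
  show "inj_on ?\<phi> zeros4"
    by (auto simp: inj_on_def)
  fix S assume "finite S" "S \<subseteq> ?\<phi> ` zeros4"
  have "rule_holds S \<rho> \<and> rule_decreasing (11, 10, 12, 13) \<rho>" if "\<rho> \<in> rules4" for \<rho>
  proof
    show "rule_decreasing (11, 10, 12, 13) \<rho>"
      using that by (auto simp: rules4_def rule_decreasing_def)
    have key: "\<forall>\<rho> \<in> rules4. mon (fst \<rho>) (d, a, b, c) = (\<Sum>(t, \<beta>) \<leftarrow> snd \<rho>. t * mon \<beta> (d, a, b, c))"
      if "sys4 1 (a, b, c, d) = (0, 0, 0, 0)" for a b c d
    proof -
      have eqs: "d = - (2 * a + b + c)"
         "b = a * b + a * c + a * d + b * c + b * d + c * d"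
         "c = - (a * b * c + a * b * d + a * c * d + b * c * d)"
         "a * b * c = 1"
        using that unfolding sys4_zero_iff by blast+
      have r1: "c = - (2 * a + b + d)"
        using eqs(1) by algebra
      have r2: "b^2 = -(d^2+2*a^2+2*a*d+b*d+2*a*b+b)"
        using eqs(1,2) by algebra
      have r3: "d^3 = -(a*d^2+b*d+c+1)"
        using eqs by algebra
      have r4: "a*d^2 = -2*a^2*d-2*a^3-a*b+1"
        using eqs by algebra
      have r5: "2*a^4 = -(b*a^2+c*a+d)"
        using eqs by algebra
      show ?thesis
        unfolding rules4_def
        apply (simp only: ball_simps simp_thms)
        apply (intro conjI)
        subgoal by (simp; use r1 in algebra)
        subgoal by (simp; use r2 in algebra)
        subgoal by (simp; use r3 in algebra)
        subgoal by (simp; use r4 in algebra)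
        subgoal by (simp; use r5 in algebra)
        done
    qed
    show "rule_holds S \<rho>"
      unfolding rule_holds_def
    proof
      fix y assume "y \<in> S"
      then obtain a b c d where "sys4 1 (a, b, c, d) = (0, 0, 0, 0)" "y = (d, a, b, c)"
        using \<open>S \<subseteq> ?\<phi> ` zeros4\<close> unfolding zeros4_def by auto
      then show "mon (fst \<rho>) y = (\<Sum>(c, \<beta>) \<leftarrow> snd \<rho>. c * mon \<beta> y)"
        using key \<open>\<rho> \<in> _\<close> by blast
    qed
  qed
  \<comment> \<open>The corners are \<open>d^3\<close>, \<open>d^2 * a\<close>, \<open>a^4\<close>,
    \<open>b^2\<close> and \<open>c\<close>, and \<open>(2 * 4 + 1) * 2 * 1 = 18\<close>.\<close>
  from card_le_staircase[where R = rules4 and p = 2 and q = 4 and r = 2 and s = 1, OF \<open>finite S\<close> this] show "card S \<le> 18"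
    by (simp add: rules4_def)
qed

lemma zeros3_bound: "finite zeros3 \<and> card zeros3 \<le> 4"
proof (rule finite_card_le_via_inj)
  let ?\<phi> = "\<lambda>(a, b, c, d). (c, a, b, d) :: complex quad"
  show "inj_on ?\<phi> zeros3"
    by (auto simp: inj_on_def)
  fix S assume "finite S" "S \<subseteq> ?\<phi> ` zeros3"
  have "rule_holds S \<rho> \<and> rule_decreasing (11, 10, 12, 13) \<rho>" if "\<rho> \<in> rules3" for \<rho>
  proof
    show "rule_decreasing (11, 10, 12, 13) \<rho>"
      using that by (auto simp: rules3_def rule_decreasing_def)
    have key: "\<forall>\<rho> \<in> rules3. mon (fst \<rho>) (c, a, b, d) = (\<Sum>(t, \<beta>) \<leftarrow> snd \<rho>. t * mon \<beta> (c, a, b, d))"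
      if "sys3 1 (a, b, c, d) = (0, 0, 0, 0)" for a b c d
    proof -
      have eqs: "c = - (2 * a + b)" "b = a * b + a * c + b * c" "a * b = - 1" "d = 0"
        using that unfolding sys3_zero_iff by blast+
      have r1: "b = - (2 * a + c)"
        using eqs(1) by algebra
      have r2: "c^2 = -(a*c+b+1)"
        using eqs by algebra
      have r3: "a*c = -2*a^2+1"
        using eqs by algebra
      have r4: "2*a^3 = -(b*a+c)"
        using eqs by algebra
      show ?thesis
        unfolding rules3_def
        apply (simp only: ball_simps simp_thms)
        apply (intro conjI)
        subgoal by (simp add: eqs(4))
        subgoal by (simp; use r1 in algebra)
        subgoal by (simp; use r2 in algebra)
        subgoal by (simp; use r3 in algebra)
        subgoal by (simp; use r4 in algebra)
        done
    qed
    show "rule_holds S \<rho>"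
      unfolding rule_holds_def
    proof
      fix y assume "y \<in> S"
      then obtain a b c d where "sys3 1 (a, b, c, d) = (0, 0, 0, 0)" "y = (c, a, b, d)"
        using \<open>S \<subseteq> ?\<phi> ` zeros3\<close> unfolding zeros3_def by auto
      then show "mon (fst \<rho>) y = (\<Sum>(c, \<beta>) \<leftarrow> snd \<rho>. c * mon \<beta> y)"
        using key \<open>\<rho> \<in> _\<close> by blast
    qed
  qed
  from card_le_staircase[where R = rules3 and p = 1 and q = 3 and r = 1 and s = 1, OF \<open>finite S\<close> this] show "card S \<le> 4"
    by (simp add: rules3_def)
qed

section \<open>Lower bounds\<close>

text \<open>The boxes live at scale \<open>s\<close>, the count at scale 1. Finiteness comes from
  the upper bound; it matters because \<open>card\<close> of an infinite set is 0.\<close>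

lemma card_zeros_ge:
  fixes f :: "int \<Rightarrow> complex quad \<Rightarrow> complex quad"
  assumes "encloses (f s) F" "continuous_on UNIV (f s)" "s \<noteq> 0"
    and scale: "\<And>x. f s (map_quad ((*) (of_int s)) x) = (0, 0, 0, 0) \<longleftrightarrow> f 1 x = (0, 0, 0, 0)"
    and fin: "finite {x. f 1 x = (0, 0, 0, 0)}"
    and boxes: "list_all (box_ok F k K r M) Xs" "separated r (map (box_key K) Xs)"
  shows "length Xs \<le> card {x. f 1 x = (0, 0, 0, 0) \<and> linear_form M x \<noteq> 0}"
proof -
  have bij: "bij_betw (map_quad ((*) (of_int s))) {x. f 1 x = (0, 0, 0, 0) \<and> linear_form M x \<noteq> 0}
      {x. f s x = (0, 0, 0, 0) \<and> linear_form M x \<noteq> 0}"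
    using \<open>s \<noteq> 0\<close> scale by (rule bij_betw_zeros_scale)
  have "finite {x. f 1 x = (0, 0, 0, 0) \<and> linear_form M x \<noteq> 0}"
    using fin by (rule rev_finite_subset) auto
  then have "finite {x. f s x = (0, 0, 0, 0) \<and> linear_form M x \<noteq> 0}"
    using bij_betw_finite[OF bij] by blast
  then show ?thesis
    using length_boxes_le_card[OF assms(1,2) boxes] bij_betw_same_card[OF bij] by simp
qed

fun tcnj :: "tmodel \<Rightarrow> tmodel" where
  "tcnj (TM v a b c d e) = TM (gcnj v) (gcnj a) (gcnj b) (gcnj c) (gcnj d) e"

text \<open>The first entry of each \<open>TM\<close> is a Newton approximation to \<open>10 ^ 6\<close> times a solution, the next four are
a row of 50 times the inverse Jacobian there; preconditioning the variables in this way makes the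
system nearly diagonal, as \<^term>\<open>isolates\<close> requires.\<close>

definition boxes3 :: "tmodel quad list" where
  "boxes3 = [
  (TM (-782599, -521714) (7, 5) (4, -7) (19, 9) (0, 0) 0,
   TM (884646, -589743) (8, -5) (-5, -7) (-27, 13) (0, 0) 0,
   TM (680552, 1633170) (27, -5) (-2, 21) (-12, -31) (0, 0) 0,
   TM (0, 0) (0, 0) (0, 0) (0, 0) (50, 0) 0),
  (TM (-782599, 521714) (7, -5) (4, 7) (19, -9) (0, 0) 0,
   TM (884646, 589743) (8, 5) (-5, 7) (-27, -13) (0, 0) 0,
   TM (680552, -1633170) (27, 5) (-2, -21) (-12, 31) (0, 0) 0,
   TM (0, 0) (0, 0) (0, 0) (0, 0) (50, 0) 0),
  (TM (565198, 0) (11, 0) (9, 0) (-22, 0) (0, 0) 0,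
   TM (-1769292, 0) (33, 0) (28, 0) (20, 0) (0, 0) 0,
   TM (638897, 0) (-4, 0) (-45, 0) (24, 0) (0, 0) 0,
   TM (0, 0) (0, 0) (0, 0) (0, 0) (50, 0) 0),
  (TM (1000000, 0) (0, 0) (-17, 0) (-17, 0) (0, 0) 0,
   TM (-1000000, 0) (0, 0) (-17, 0) (33, 0) (0, 0) 0,
   TM (-1000000, 0) (50, 0) (50, 0) (0, 0) (0, 0) 0,
   TM (0, 0) (0, 0) (0, 0) (0, 0) (50, 0) 0)]"

definition boxes4 :: "tmodel quad list" where
  "boxes4 = [
  (TM (-860365, -351946) (6, -5) (6, -5) (7, -4) (-9, -7) 0,
   TM (-483172, 818304) (9, -5) (12, 20) (-9, 11) (-11, 16) 0,
   TM (901787, 684301) (14, 7) (-16, 6) (-2, -15) (20, 7) 0,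
   TM (1302114, -798713) (16, 8) (-7, -15) (-3, 11) (10, -8) 0),
  (TM (-860365, 351946) (6, 5) (6, 5) (7, 4) (-9, 7) 0,
   TM (-483172, -818304) (9, 5) (12, -20) (-9, -11) (-11, -16) 0,
   TM (901787, -684301) (14, -7) (-16, -6) (-2, 15) (20, -7) 0,
   TM (1302114, 798713) (16, -8) (-7, 15) (-3, -11) (10, 8) 0),
  (TM (-793257, -579047) (9, 1) (0, 0) (2, -8) (-7, -8) 0,
   TM (498567, 619229) (9, 14) (-12, 0) (-1, -11) (20, 12) 0,
   TM (-60577, 1279345) (10, -16) (16, 13) (-1, 11) (-11, 15) 0,
   TM (1148524, -740479) (14, 0) (-4, -12) (-2, 16) (4, -12) 0),
  (TM (-793257, 579047) (9, -1) (0, 0) (2, 8) (-7, 8) 0,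
   TM (498567, -619229) (9, -14) (-12, 0) (-1, 11) (20, -12) 0,
   TM (-60577, -1279345) (10, 16) (16, -13) (-1, -11) (-11, -15) 0,
   TM (1148524, 740479) (14, 0) (-4, 12) (-2, -16) (4, 12) 0),
  (TM (-510456, -1036387) (5, 1) (3, -8) (-1, -4) (-7, -13) 0,
   TM (1034672, -320960) (6, -1) (-4, -4) (4, 7) (15, -5) 0,
   TM (-549568, 580016) (4, 1) (1, -1) (7, 2) (-13, 12) 0,
   TM (535809, 1813718) (30, 0) (-3, 21) (-9, 0) (11, 19) 0),
  (TM (-510456, 1036387) (5, -1) (3, 8) (-1, 4) (-7, 13) 0,
   TM (1034672, 320960) (6, 1) (-4, 4) (4, -7) (15, 5) 0,
   TM (-549568, -580016) (4, -1) (1, 1) (7, -2) (-13, -12) 0,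
   TM (535809, -1813718) (30, 0) (-3, -21) (-9, 0) (11, -19) 0),
  (TM (-371786, -430050) (0, -3) (7, -10) (-3, -3) (-8, -14) 0,
   TM (-1318664, 587282) (21, 2) (8, 13) (11, 7) (-5, 15) 0,
   TM (1103076, -517884) (13, 0) (-9, -9) (1, 10) (17, -4) 0,
   TM (959161, 790702) (16, 4) (-13, 16) (-7, -10) (5, 18) 0),
  (TM (-371786, 430050) (0, 3) (7, 10) (-3, 3) (-8, 14) 0,
   TM (-1318664, -587282) (21, -2) (8, -13) (11, -7) (-5, -15) 0,
   TM (1103076, 517884) (13, 0) (-9, 9) (1, -10) (17, 4) 0,
   TM (959161, -790702) (16, -4) (-13, -16) (-7, 10) (5, -18) 0),
  (TM (112740, -624879) (10, 2) (3, -2) (-7, 4) (-4, -18) 0,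
   TM (849096, -174696) (0, -3) (-10, -2) (8, 3) (13, 7) 0,
   TM (-44347, 1816183) (23, -2) (-1, 13) (-7, 0) (0, 19) 0,
   TM (-1030229, -391730) (7, 1) (6, -7) (12, -11) (-5, 10) 0),
  (TM (112740, 624879) (10, -2) (3, 2) (-7, -4) (-4, 18) 0,
   TM (849096, 174696) (0, 3) (-10, 2) (8, -3) (13, -7) 0,
   TM (-44347, -1816183) (23, 2) (-1, -13) (-7, 0) (0, -19) 0,
   TM (-1030229, 391730) (7, -1) (6, 7) (12, 11) (-5, -10) 0),
  (TM (184043, -863183) (10, 6) (1, -3) (-8, 2) (-3, -12) 0,
   TM (-69248, 1213747) (11, 4) (-9, 6) (-4, -6) (-2, 21) 0,
   TM (898948, -245948) (0, -3) (-10, -4) (9, 3) (19, 0) 0,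
   TM (-1197786, 758568) (19, -12) (17, 5) (11, -1) (-11, 3) 0),
  (TM (184043, 863183) (10, -6) (1, 3) (-8, -2) (-3, 12) 0,
   TM (-69248, -1213747) (11, -4) (-9, -6) (-4, 6) (-2, -21) 0,
   TM (898948, 245948) (0, 3) (-10, 4) (9, -3) (19, 0) 0,
   TM (-1197786, -758568) (19, 12) (17, -5) (11, 1) (-11, -3) 0),
  (TM (739081, -85644) (10, -4) (11, -9) (-20, 1) (27, -3) 0,
   TM (-1511249, 544425) (19, 20) (-2, 8) (9, 39) (-20, -9) 0,
   TM (-749319, -372313) (13, -12) (19, -3) (-8, -29) (-6, 5) 0,
   TM (782407, -824) (-2, 0) (-40, 12) (39, -12) (-27, 10) 0),
  (TM (739081, 85644) (10, 4) (11, 9) (-20, -1) (27, 3) 0,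
   TM (-1511249, -544425) (19, -20) (-2, -8) (9, -39) (-20, 9) 0,
   TM (-749319, 372313) (13, 12) (19, 3) (-8, 29) (-6, -5) 0,
   TM (782407, 824) (-2, 0) (-40, -12) (39, 12) (-27, -10) 0),
  (TM (1000000, 0) (0, 0) (-26, 0) (26, 0) (-8, 0) 0,
   TM (-1754878, 0) (84, 0) (102, 0) (-38, 0) (45, 0) 0,
   TM (-569840, 0) (-27, 0) (-48, 0) (27, 0) (-48, 0) 0,
   TM (324718, 0) (-7, 0) (-2, 0) (-41, 0) (20, 0) 0),
  (TM (1000000, 0) (0, 0) (-9, 0) (9, 0) (15, 6) 0,
   TM (-122561, -744862) (8, 0) (0, -1) (-7, 7) (-7, -20) 0,
   TM (-215080, 1307141) (14, 4) (-1, 11) (-14, -4) (-1, 11) 0,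
   TM (-1662359, -562280) (28, -3) (19, -9) (3, -4) (-21, -2) 0),
  (TM (1000000, 0) (0, 0) (-9, 0) (9, 0) (15, -6) 0,
   TM (-122561, 744862) (8, 0) (0, 1) (-7, -7) (-7, 20) 0,
   TM (-215080, -1307141) (14, -4) (-1, -11) (-14, 4) (-1, -11) 0,
   TM (-1662359, 562280) (28, 3) (19, 9) (3, 4) (-21, 2) 0)]"

definition half_boxes5 :: "tmodel quad list" where
  "half_boxes5 = [
  (TM (-1092602, -120305) (7, -2) (4, 0) (4, 0) (14, 3) 0,
   TM (-90784, -1145033) (3, -10) (-8, -1) (-3, 3) (-1, 14) 0,
   TM (1038208, -380189) (-7, -4) (2, 8) (1, -7) (-13, -2) 0,
   TM (-225672, 679886) (-1, 1) (0, 3) (-6, 0) (-3, -12) 0),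
  (TM (-1064942, -78698) (9, 1) (6, 1) (3, 1) (12, -2) 0,
   TM (-432590, -818543) (-5, -5) (-3, -6) (-8, 2) (-6, 15) 0,
   TM (1191308, 894445) (-14, 14) (-2, -11) (4, 3) (-11, 2) 0,
   TM (155855, 660857) (7, 0) (-3, 3) (-7, 0) (-7, -14) 0),
  (TM (-1005514, 533885) (4, 3) (4, 5) (-2, 4) (2, 2) 0,
   TM (282080, 330981) (-2, 1) (-1, 10) (-4, -6) (-13, -22) 0,
   TM (987224, -1324138) (-11, -15) (-4, 3) (7, -3) (2, 9) 0,
   TM (1040482, 642593) (-5, 10) (-4, -18) (7, 8) (9, 16) 0),
  (TM (-929671, -423886) (2, -3) (5, -3) (3, -4) (11, -5) 0,
   TM (949064, -466012) (-8, -4) (1, 9) (2, -6) (-12, -3) 0,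
   TM (51261, 1039989) (4, -3) (9, 8) (-8, 3) (-3, -10) 0,
   TM (69180, -886303) (7, -8) (-4, 1) (-8, 5) (-5, 21) 0),
  (TM (-925395, -531919) (5, -4) (5, -2) (0, -7) (7, -6) 0,
   TM (876652, -596964) (-6, -8) (0, 17) (5, -8) (4, -12) 0,
   TM (817642, 1572761) (-6, 19) (-16, -10) (8, 7) (2, 9) 0,
   TM (262833, -423382) (-3, 1) (-4, -15) (-5, 7) (-17, 25) 0),
  (TM (-909088, -481720) (3, -4) (8, -5) (2, -7) (11, -14) 0,
   TM (-325436, -647634) (7, -5) (-10, 5) (-2, 10) (3, 33) 0,
   TM (-297143, 1033328) (7, 4) (-2, 6) (-7, 5) (-5, -2) 0,
   TM (1190919, -370527) (-7, -10) (1, 10) (3, -6) (-7, -4) 0),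
  (TM (-843907, -372728) (2, -1) (2, -2) (2, -6) (9, -6) 0,
   TM (769497, 952501) (-7, 6) (-2, -7) (6, 6) (4, -5) 0,
   TM (584563, -245521) (-4, 0) (10, -2) (-8, -4) (-27, 4) 0,
   TM (857402, -1101900) (-1, -13) (-12, 8) (5, 2) (5, 6) 0),
  (TM (-843757, -89353) (5, 2) (8, -3) (6, 2) (15, -5) 0,
   TM (856594, 356235) (-5, 1) (2, -8) (0, 6) (-15, -2) 0,
   TM (72976, 1510847) (4, 11) (-8, 5) (-6, -3) (-3, -9) 0,
   TM (-366346, -755775) (-1, -3) (-3, -5) (-8, -2) (-6, 14) 0),
  (TM (-774824, -30293) (1, -6) (10, 1) (6, -7) (20, -11) 0,
   TM (-774721, 986562) (4, 13) (-8, 4) (-10, 5) (-14, -1) 0,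
   TM (-148812, -695611) (11, 1) (-8, -6) (-8, 4) (-13, 21) 0,
   TM (1272462, -685300) (-10, -16) (-1, 12) (4, -2) (-8, 3) 0),
  (TM (-674036, 313002) (3, -1) (0, 5) (-1, 4) (10, 0) 0,
   TM (785136, -1023030) (-5, -7) (-2, 7) (5, -5) (1, 5) 0,
   TM (664675, 1259407) (-1, 15) (-13, -9) (6, -3) (4, -5) 0,
   TM (707000, 192453) (-5, 0) (9, 2) (-8, 5) (-25, -2) 0),
  (TM (-617007, 587474) (9, 3) (0, 4) (-3, 6) (10, 7) 0,
   TM (124359, 649386) (-8, 6) (-8, -2) (3, -9) (-3, -26) 0,
   TM (923697, 300474) (-5, 2) (7, -7) (-2, 9) (-9, 16) 0,
   TM (1084989, -1470730) (-8, -12) (-2, 6) (5, -3) (-5, 3) 0),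
  (TM (-563356, -753683) (2, -5) (-5, -3) (-7, -4) (-5, 3) 0,
   TM (-896742, 201586) (1, 2) (14, -9) (15, 6) (30, 8) 0,
   TM (-208148, 965844) (19, 9) (-4, 14) (-7, -3) (-6, -19) 0,
   TM (931117, 708929) (-19, 12) (0, -8) (4, 12) (-12, 8) 0),
  (TM (-444774, -810387) (3, -4) (-1, -1) (-6, 0) (-5, 9) 0,
   TM (-661906, 1249716) (8, 19) (-13, 10) (-3, -6) (-5, -22) 0,
   TM (-670342, 350851) (3, 0) (6, -8) (9, 0) (23, -3) 0,
   TM (888667, 482089) (-11, 4) (4, -9) (5, 12) (-7, 7) 0),
  (TM (-413740, 1043548) (0, 4) (-2, 4) (-3, -3) (-2, -11) 0,
   TM (440603, -506214) (-9, 2) (3, 2) (2, -9) (-14, -2) 0,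
   TM (-756849, -394187) (4, -1) (6, 3) (7, -2) (16, -3) 0,
   TM (-4742, -1555481) (9, -18) (-8, -5) (-3, 7) (2, 23) 0),
  (TM (-405068, -437402) (4, 6) (2, 2) (3, -10) (20, -4) 0,
   TM (889083, -199673) (-6, -2) (6, 5) (-2, -7) (-13, -7) 0,
   TM (-49226, -1170862) (0, -18) (-9, -8) (-8, 13) (-23, 19) 0,
   TM (835489, 1330190) (-5, 7) (-6, -10) (4, 5) (-5, -6) 0),
  (TM (-365662, -711775) (-5, -5) (-1, -5) (-6, 3) (-3, 12) 0,
   TM (-1362009, 286557) (21, -1) (10, 3) (6, -2) (15, -5) 0,
   TM (834167, 690472) (-18, 12) (-1, -10) (7, 10) (-7, 5) 0,
   TM (7865, 829125) (12, 10) (-7, 6) (-4, -5) (-1, -20) 0),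
  (TM (-323807, 507888) (5, 3) (-9, -4) (-2, -7) (0, -25) 0,
   TM (-1129844, 431951) (3, 8) (11, 12) (0, 12) (7, 25) 0,
   TM (-493949, -1018511) (6, -8) (3, -5) (-6, 0) (-2, 14) 0,
   TM (1175089, 298973) (-7, 10) (1, -8) (0, 7) (-10, 5) 0),
  (TM (-319276, -754178) (-3, -1) (-4, -5) (-10, 3) (-2, 14) 0,
   TM (600914, 240205) (-2, 1) (1, -2) (3, 12) (-8, -1) 0,
   TM (48342, 1828635) (4, 14) (-5, 2) (1, -5) (1, -17) 0,
   TM (-1030331, -48068) (9, -1) (9, -3) (10, 3) (14, -6) 0),
  (TM (-261672, -608646) (7, -2) (-8, -2) (-4, 4) (-7, 19) 0,
   TM (-973758, 1250455) (3, 14) (-1, 7) (-5, 0) (-2, -13) 0,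
   TM (-719851, -68248) (1, -5) (10, -2) (2, -8) (16, -14) 0,
   TM (1237207, -451789) (-10, -13) (6, 9) (2, -8) (-6, -8) 0),
  (TM (-259132, 1018722) (-3, 10) (-6, 6) (-4, -7) (-12, -14) 0,
   TM (999696, 212743) (-3, 5) (5, -4) (-4, 5) (-12, 9) 0,
   TM (-378964, 373795) (6, -8) (2, -4) (3, 11) (25, 4) 0,
   TM (549664, -1659973) (-8, -23) (-6, 2) (14, 7) (20, 9) 0),
  (TM (-224669, 1163904) (2, 7) (-4, 1) (-4, -3) (-4, -12) 0,
   TM (1047928, 200799) (-4, 3) (3, -4) (-2, 5) (-11, 3) 0,
   TM (-720068, 156853) (0, 5) (7, 3) (4, 1) (16, -2) 0,
   TM (-176773, -1058183) (7, 3) (7, -6) (-8, -7) (-7, 12) 0),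
  (TM (-117475, -796898) (0, 1) (-3, -5) (-10, 5) (-1, 9) 0,
   TM (-251612, 1370940) (-4, 13) (-11, -2) (4, -4) (4, -16) 0,
   TM (636473, 247729) (-1, 1) (1, -1) (5, 12) (-13, 0) 0,
   TM (-1197903, 515429) (11, -1) (9, -1) (6, -4) (13, -2) 0),
  (TM (-50605, 814522) (5, 8) (-4, 1) (-2, -2) (0, -14) 0,
   TM (-1485396, -465039) (21, -2) (13, 0) (6, -2) (7, -2) 0,
   TM (1118193, 273274) (-8, 7) (3, -7) (-1, 8) (-10, 5) 0,
   TM (-389066, -562462) (-7, -2) (-3, -3) (-9, 2) (3, 16) 0),
  (TM (-17907, 604125) (2, 3) (-12, -1) (3, 1) (2, -16) 0,
   TM (817454, 239079) (-10, 5) (9, -3) (-5, 10) (-14, 7) 0,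
   TM (37454, -1791678) (1, -13) (-4, -1) (0, 7) (-1, 18) 0,
   TM (-1023747, 356465) (5, 6) (14, 8) (-2, 10) (3, 11) 0),
  (TM (47, -1123640) (0, -6) (-3, 0) (0, 6) (1, 15) 0,
   TM (1016585, -180130) (-4, -3) (4, 4) (-4, -5) (-14, 0) 0,
   TM (28811, 772386) (0, 0) (5, 0) (1, 7) (1, -11) 0,
   TM (-1090157, -235338) (4, -4) (5, -5) (2, -6) (12, -1) 0),
  (TM (96219, -997936) (2, -3) (-4, 3) (-4, 8) (-2, 11) 0,
   TM (-361918, 666331) (-11, 9) (-5, 6) (-14, 1) (4, -19) 0,
   TM (1023991, -228367) (-6, -5) (4, 4) (-4, -8) (-12, -1) 0,
   TM (-1166997, 458371) (20, -3) (13, -1) (3, 4) (6, 1) 0),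
  (TM (164276, 975586) (-1, 7) (-7, -1) (3, -3) (2, -15) 0,
   TM (480089, -952477) (-6, -4) (3, 4) (5, -2) (4, 11) 0,
   TM (-827969, 442286) (3, -1) (3, 5) (0, 6) (12, 5) 0,
   TM (991268, 191220) (-5, 4) (6, -4) (-6, 4) (-21, 3) 0),
  (TM (206660, -687156) (-7, -2) (-6, 3) (4, 7) (1, 23) 0,
   TM (-855660, -362649) (5, -9) (-3, -6) (-9, -7) (3, -12) 0,
   TM (979396, -166670) (-6, -5) (6, 4) (-5, -5) (-18, -11) 0,
   TM (755829, 1306554) (-1, 12) (0, -7) (7, -4) (8, -15) 0),
  (TM (301944, -592800) (5, -7) (-4, 6) (13, -6) (2, 13) 0,
   TM (-142365, 1218335) (-9, 7) (-2, -4) (4, -9) (6, -15) 0,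
   TM (800830, -113451) (-11, 2) (13, -1) (-8, -2) (-15, -5) 0,
   TM (-1366421, 654497) (14, 7) (6, 0) (4, 10) (7, -2) 0),
  (TM (316419, 1066198) (-3, 5) (-7, -1) (1, -1) (1, -12) 0,
   TM (96910, -1126862) (-10, 1) (0, 9) (10, 3) (4, 13) 0,
   TM (979470, 171266) (-5, 3) (6, -2) (-5, 3) (-17, 1) 0,
   TM (-799174, -23662) (-3, 0) (-4, 3) (-6, 9) (10, 4) 0),
  (TM (377824, -514354) (-5, -3) (-12, -3) (6, 5) (11, 22) 0,
   TM (-1438549, -220658) (5, -17) (8, -18) (-6, -5) (-6, 2) 0,
   TM (601134, 925760) (-1, 13) (6, -1) (8, 0) (5, -20) 0,
   TM (953973, -203169) (-8, -7) (11, 7) (-9, -8) (-26, -13) 0),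
  (TM (394883, -704375) (2, -3) (-2, 6) (8, 3) (4, 14) 0,
   TM (915845, -104485) (-7, 0) (7, 1) (-7, 0) (-15, -6) 0,
   TM (-116035, 1854266) (-4, 14) (-6, -1) (-3, -8) (0, -19) 0,
   TM (-647984, 320927) (3, 0) (1, 4) (-3, 11) (9, 0) 0),
  (TM (414551, -500723) (2, -2) (-3, 2) (8, -2) (4, 15) 0,
   TM (905693, -86339) (-8, 0) (8, 1) (-8, -1) (-16, -11) 0,
   TM (-880677, 662919) (4, -1) (7, 2) (2, 8) (8, 0) 0,
   TM (-74775, 1532102) (-4, 13) (-7, 1) (-1, -7) (5, -21) 0),
  (TM (556444, -373100) (8, -8) (-10, -4) (16, 3) (16, 23) 0,
   TM (-1824028, 480563) (12, 15) (12, 6) (-5, 5) (1, -9) 0,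
   TM (863490, -177083) (-17, -1) (18, 5) (-18, -4) (-33, -16) 0,
   TM (446269, 778961) (-10, 13) (-8, 0) (4, -5) (9, -22) 0),
  (TM (571845, 14556) (1, 2) (-1, -1) (11, 1) (-9, 3) 0,
   TM (-325179, 770135) (0, -2) (-12, -1) (1, -12) (9, -15) 0,
   TM (-153098, -1301706) (1, -10) (-11, 1) (-7, 6) (1, 7) 0,
   TM (-1520455, 483526) (14, 5) (6, 4) (2, 1) (14, 1) 0),
  (TM (651499, 618576) (2, 6) (-3, -5) (8, 1) (8, -10) 0,
   TM (-161696, -747049) (-10, 0) (0, 6) (7, 1) (10, 16) 0,
   TM (-983227, -1263529) (13, -13) (1, -7) (-8, -6) (1, 0) 0,
   TM (903605, 104335) (-9, -3) (9, 2) (-9, -3) (-23, 2) 0),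
  (TM (653345, -542229) (8, -9) (-1, 4) (11, 1) (10, 12) 0,
   TM (-1418616, 635722) (8, 28) (-1, 22) (-12, 0) (-1, -17) 0,
   TM (241586, 795985) (-17, 4) (-9, -11) (7, -3) (11, -15) 0,
   TM (898869, -147001) (-14, 2) (12, 1) (-14, 0) (-31, -4) 0),
  (TM (814225, 188609) (4, 13) (-8, -11) (15, 8) (-5, 0) 0,
   TM (-969770, -862141) (-18, -8) (-2, -9) (-14, 17) (-5, 17) 0,
   TM (-1190257, -208479) (20, 2) (8, 5) (6, -1) (20, 4) 0,
   TM (-327134, 689393) (10, -1) (-11, 7) (-2, -13) (0, -19) 0),
  (TM (927708, -42559) (36, -26) (-47, 27) (51, -25) (0, -2) 0,
   TM (-1971602, -207977) (3, 19) (36, -37) (-22, 29) (11, 2) 0,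
   TM (-430276, 809873) (-12, -15) (4, 33) (-15, -36) (-1, -18) 0,
   TM (-308357, -505642) (17, 10) (-25, -11) (16, 18) (5, 16) 0),
  (TM (1000000, 0) (-17, -1) (17, 1) (-17, -1) (-29, 3) 0,
   TM (-2069102, -213528) (33, -13) (-4, -2) (18, -5) (28, -6) 0,
   TM (375759, 540659) (7, 11) (-11, -2) (18, 3) (18, -14) 0,
   TM (352957, -639186) (-1, -11) (-12, -1) (13, 3) (15, 14) 0),
  (TM (1000000, 0) (-49, -26) (49, 26) (-49, -26) (-15, -3) 0,
   TM (-2034420, 219284) (51, 40) (-19, -27) (35, 33) (19, 5) 0,
   TM (-398238, -773844) (8, -38) (-15, 28) (2, -26) (0, 10) 0,
   TM (-308981, 468890) (-21, 11) (16, -14) (-26, 10) (0, -11) 0),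
  (TM (1000000, 0) (-8, -3) (8, 3) (-8, -3) (-22, -5) 0,
   TM (-1083914, -427935) (-2, -16) (-10, -4) (-10, -4) (4, -7) 0,
   TM (114777, -789371) (-8, 3) (-4, 6) (9, 5) (7, 22) 0,
   TM (534921, 933368) (3, 5) (-6, -8) (11, -1) (13, -10) 0),
  (TM (1000000, 0) (-12, -9) (12, 9) (-12, -9) (-9, 0) 0,
   TM (-790937, -719913) (-2, -19) (-16, 13) (-1, -4) (-3, 17) 0,
   TM (-1235372, -206768) (22, 1) (9, -1) (8, 4) (20, 5) 0,
   TM (-461523, 586707) (-4, 12) (-1, -8) (-12, 5) (-2, -16) 0),
  (TM (1000000, 0) (-7, 3) (7, -3) (-7, 3) (-11, -4) 0,
   TM (-213249, 1019669) (-2, 4) (-3, -4) (6, -7) (4, -10) 0,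
   TM (45462, -532126) (1, -6) (1, 2) (2, -10) (3, 11) 0,
   TM (-1721659, 516374) (16, 6) (3, 5) (8, 2) (15, 1) 0),
  (TM (1000000, 0) (-9, 2) (9, -2) (-9, 2) (-9, -3) 0,
   TM (-202966, -403313) (-7, -3) (-3, 5) (-6, -6) (5, 12) 0,
   TM (-264882, 1306737) (-2, 8) (-12, -4) (1, -8) (-3, -8) 0,
   TM (-1602607, -437065) (19, -10) (5, -5) (6, -6) (13, -1) 0),
  (TM (1000000, 0) (-7, 3) (7, -3) (-7, 3) (-18, 3) 0,
   TM (-161634, 661160) (-7, 0) (-3, -4) (7, -1) (8, -16) 0,
   TM (-1057656, 954792) (14, 10) (-5, 9) (-2, 7) (14, 8) 0,
   TM (489419, -907574) (2, -8) (-4, 9) (10, -1) (11, 9) 0),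
  (TM (1000000, 0) (-6, 0) (6, 0) (-6, 0) (-16, 4) 0,
   TM (249685, 827647) (0, 0) (-3, -7) (7, -1) (5, -14) 0,
   TM (16754, -1406298) (-5, -11) (-10, 5) (3, 2) (0, 9) 0,
   TM (-790214, -228158) (2, -3) (-3, -6) (-4, -7) (12, -1) 0),
  (TM (1000000, 0) (-7, -1) (7, 1) (-7, -1) (-17, 7) 0,
   TM (306538, 608279) (2, 1) (-2, -3) (9, 2) (6, -15) 0,
   TM (-1096603, -543841) (8, -3) (2, -6) (4, -8) (15, -6) 0,
   TM (7687, -1199353) (-4, -11) (-9, 4) (4, 1) (1, 11) 0)]"

text \<open>The system has real coefficients, so conjugation maps zeros to zeros, and every listed
  approximation is nonreal. The conjugate boxes undergo the same check as the listed ones.\<close>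

definition boxes5 :: "tmodel quad list" where
  "boxes5 = half_boxes5 @ map (map_quad tcnj) half_boxes5"

text \<open>At scale \<open>10 ^ 6\<close> an equation of degree n has derivatives
  \<open>10 ^ (6 * (n - 1))\<close> times those at scale 1. Against rows of 50 times the inverse
  Jacobian this leaves about \<open>50 * 10 ^ (6 * (n - 1))\<close> on the diagonal, here for n = 1,
  2, 2, 1. The key is the real minus the imaginary part of \<open>b\<close>.\<close>

lemma boxes3_ok:
  "length boxes3 = 4"
  "list_all (box_ok (tsys3 (10 ^ 6)) (50, 50 * 10 ^ 6, 50 * 10 ^ 6, 50)
     ((0, 0), (1, 1), (0, 0), (0, 0)) 5000 last3) boxes3"
  "separated 5000 (map (box_key ((0, 0), (1, 1), (0, 0), (0, 0))) boxes3)"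
  by code_simp+

text \<open>The degrees are 1, 2, 3, 3, and minus the imaginary part of \<open>b\<close> suffices as
  key.\<close>

lemma boxes4_ok:
  "length boxes4 = 17"
  "list_all (box_ok (tsys4 (10 ^ 6)) (50, 50 * 10 ^ 6, 50 * 10 ^ 12, 50 * 10 ^ 12)
     ((0, 0), (0, 1), (0, 0), (0, 0)) 5000 last4) boxes4"
  "separated 5000 (map (box_key ((0, 0), (0, 1), (0, 0), (0, 0))) boxes4)"
  by code_simp+

lemma length_boxes5: "length boxes5 = 96"
  by code_simp

text \<open>The degrees are 2, 3, 4, 4. The key mixes all four coordinates; a tolerance of 5000 is
  0.005 at the original scale.\<close>

lemma boxes5_ok:
  "list_all (box_ok (tsys5 (10 ^ 6)) (50 * 10 ^ 6, 50 * 10 ^ 12, 50 * 10 ^ 18, 50 * 10 ^ 18)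
     ((0, 3), (1, 0), (1, -4), (0, 2)) 5000 last5) boxes5"
  by code_simp

lemma boxes5_separated:
  "separated 5000 (map (box_key ((0, 3), (1, 0), (1, -4), (0, 2))) boxes5)"
  by code_simp

lemma zeros3_ge: "4 \<le> card {x. sys3 1 x = (0, 0, 0, 0) \<and> linear_form last3 x \<noteq> 0}"
  using card_zeros_ge[OF encloses_sys3 continuous_on_sys3 _ sys3_scale
      zeros3_bound[unfolded zeros3_def, THEN conjunct1] boxes3_ok(2,3)]
  by (simp add: boxes3_ok(1))

lemma zeros4_ge: "17 \<le> card {x. sys4 1 x = (0, 0, 0, 0) \<and> linear_form last4 x \<noteq> 0}"
  using card_zeros_ge[OF encloses_sys4 continuous_on_sys4 _ sys4_scale
      zeros4_bound[unfolded zeros4_def, THEN conjunct1] boxes4_ok(2,3)]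
  by (simp add: boxes4_ok(1))

lemma zeros5_ge: "96 \<le> card {x. sys5 1 x = (0, 0, 0, 0) \<and> linear_form last5 x \<noteq> 0}"
  using card_zeros_ge[OF encloses_sys5 continuous_on_sys5 _ sys5_scale
      zeros5_bound[unfolded zeros5_def, THEN conjunct1] boxes5_ok boxes5_separated]
  by (simp add: length_boxes5)

section \<open>The count\<close>

lemma linear_form_last:
  "linear_form last3 (a, b, c, d) = c" "linear_form last4 (a, b, c, d) = d"
  by (simp_all add: gval_of_int del: gval.simps)

text \<open>The unknowns are the coefficients themselves, so reordering the zeros of a polynomial
  gives no further point, and points can be counted in place of polynomials.\<close>

lemma ulam_5_nonzero:
  "{p \<in> ulam_polys 5. coeff p 0 \<noteq> 0} = (\<lambda>(a, b, c, d). [:linear_form last5 (a, b, c, d), d, c, b, a, 1:]) `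
     {x. sys5 1 x = (0, 0, 0, 0) \<and> linear_form last5 x \<noteq> 0}"
proof -
  have prod: "[:- a, 1:] * ([:- b, 1:] * ([:- c, 1:] * ([:- d, 1:] * [:- e, 1:]))) =
      [:- (a*b*c*d*e), a*b*c*d + a*b*c*e + a*b*d*e + a*c*d*e + b*c*d*e,
       - (a*b*c + a*b*d + a*b*e + a*c*d + a*c*e + a*d*e + b*c*d + b*c*e + b*d*e + c*d*e),
       a * b + a * c + a * d + a * e + b * c + b * d + b * e + c * d + c * e + d * e,
       - (a + b + c + d + e), 1:]" for a b c d e :: complex
    by (simp add: algebra_simps)
  have eq: "[:e, d, c, b, a, 1:] = [:- a, 1:] * ([:- b, 1:] * ([:- c, 1:] * ([:- d, 1:] * [:- e, 1:]))) \<longleftrightarrow>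
      sys5 1 (a, b, c, d) = (0, 0, 0, 0) \<and> e = linear_form last5 (a, b, c, d)"
    if "e \<noteq> 0" for a b c d e
  proof -
    have "e = - (a * b * c * d * e) \<longleftrightarrow> a * b * c * d = - 1"
      using that by algebra
    moreover have "a = - (a + b + c + d + e) \<longleftrightarrow> e = - (2 * a + b + c + d)"
      by (intro iffI; algebra)
    ultimately show ?thesis
      unfolding sys5_zero_iff prod pCons_eq_iff by blast
  qed
  show ?thesis
  proof (intro equalityI subsetI)
    fix p assume "p \<in> {p \<in> ulam_polys 5. coeff p 0 \<noteq> 0}"
    then obtain a b c d e where p: "p = [:e, d, c, b, a, 1:]" "p = [:- a, 1:] * ([:- b, 1:] * ([:- c, 1:] * ([:- d, 1:] * [:- e, 1:])))" and "coeff p 0 \<noteq> 0"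
      unfolding mem_Collect_eq mem_ulam_polys_5 by blast
    then have "e \<noteq> 0"
      by (metis coeff_pCons_0)
    then have "sys5 1 (a, b, c, d) = (0, 0, 0, 0) \<and> e = linear_form last5 (a, b, c, d)"
      using eq p by metis
    then show "p \<in> (\<lambda>(a, b, c, d). [:linear_form last5 (a, b, c, d), d, c, b, a, 1:]) `
        {x. sys5 1 x = (0, 0, 0, 0) \<and> linear_form last5 x \<noteq> 0}"
      using p(1) \<open>e \<noteq> 0\<close> by (intro image_eqI[of _ _ "(a, b, c, d)"]) (simp_all only: mem_Collect_eq prod.case simp_thms)
  next
    fix p assume "p \<in> (\<lambda>(a, b, c, d). [:linear_form last5 (a, b, c, d), d, c, b, a, 1:]) `
        {x. sys5 1 x = (0, 0, 0, 0) \<and> linear_form last5 x \<noteq> 0}"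
    then obtain a b c d e where "p = [:e, d, c, b, a, 1:]" "sys5 1 (a, b, c, d) = (0, 0, 0, 0)"
        "e = linear_form last5 (a, b, c, d)" "e \<noteq> 0"
      by (auto simp del: linear_form.simps sys5.simps)
    then show "p \<in> {p \<in> ulam_polys 5. coeff p 0 \<noteq> 0}"
      unfolding mem_Collect_eq mem_ulam_polys_5 using eq[of e d c b a] by (metis coeff_pCons_0)
  qed
qed

lemma ulam_4_nonzero:
  "{p \<in> ulam_polys 4. coeff p 0 \<noteq> 0} = (\<lambda>(a, b, c, d). [:d, c, b, a, 1:]) `
     {x. sys4 1 x = (0, 0, 0, 0) \<and> linear_form last4 x \<noteq> 0}"
proof -
  have prod: "[:- a, 1:] * ([:- b, 1:] * ([:- c, 1:] * [:- d, 1:])) =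
      [:a * b * c * d, - (a * b * c + a * b * d + a * c * d + b * c * d),
       a * b + a * c + a * d + b * c + b * d + c * d, - (a + b + c + d), 1:]" for a b c d :: complex
    by (simp add: algebra_simps)
  have eq: "[:d, c, b, a, 1:] = [:- a, 1:] * ([:- b, 1:] * ([:- c, 1:] * [:- d, 1:])) \<longleftrightarrow>
      sys4 1 (a, b, c, d) = (0, 0, 0, 0)"
    if "d \<noteq> 0" for a b c d
  proof -
    have "d = a * b * c * d \<longleftrightarrow> a * b * c = 1"
      using that by simp
    moreover have "a = - (a + b + c + d) \<longleftrightarrow> d = - (2 * a + b + c)"
      by (intro iffI; algebra)
    ultimately show ?thesis
      unfolding sys4_zero_iff prod pCons_eq_iff by blast
  qed
  show ?thesis
  proof (intro equalityI subsetI)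
    fix p assume "p \<in> {p \<in> ulam_polys 4. coeff p 0 \<noteq> 0}"
    then obtain a b c d where p: "p = [:d, c, b, a, 1:]" "p = [:- a, 1:] * ([:- b, 1:] * ([:- c, 1:] * [:- d, 1:]))" and "coeff p 0 \<noteq> 0"
      unfolding mem_Collect_eq mem_ulam_polys_4 by blast
    then have "d \<noteq> 0"
      by (metis coeff_pCons_0)
    then have "sys4 1 (a, b, c, d) = (0, 0, 0, 0)"
      using eq p by metis
    then show "p \<in> (\<lambda>(a, b, c, d). [:d, c, b, a, 1:]) `
        {x. sys4 1 x = (0, 0, 0, 0) \<and> linear_form last4 x \<noteq> 0}"
      using p(1) \<open>d \<noteq> 0\<close>
      by (intro image_eqI[of _ _ "(a, b, c, d)"]) (simp_all only: mem_Collect_eq prod.case simp_thms linear_form_last)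
  next
    fix p assume "p \<in> (\<lambda>(a, b, c, d). [:d, c, b, a, 1:]) `
        {x. sys4 1 x = (0, 0, 0, 0) \<and> linear_form last4 x \<noteq> 0}"
    then obtain a b c d where "p = [:d, c, b, a, 1:]" "sys4 1 (a, b, c, d) = (0, 0, 0, 0)" "d \<noteq> 0"
      by (auto simp: linear_form_last simp del: linear_form.simps sys4.simps)
    then show "p \<in> {p \<in> ulam_polys 4. coeff p 0 \<noteq> 0}"
      unfolding mem_Collect_eq mem_ulam_polys_4 using eq[of d c b a] by (metis coeff_pCons_0)
  qed
qed

text \<open>The fourth equation fixes the dummy coordinate at 0, so it does not multiply the
  points.\<close>

lemma ulam_3_nonzero:
  "{p \<in> ulam_polys 3. coeff p 0 \<noteq> 0} = (\<lambda>(a, b, c, d). [:c, b, a, 1:]) `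
     {x. sys3 1 x = (0, 0, 0, 0) \<and> linear_form last3 x \<noteq> 0}"
proof -
  have prod: "[:- a, 1:] * ([:- b, 1:] * [:- c, 1:]) =
      [:- (a * b * c), a * b + a * c + b * c, - (a + b + c), 1:]" for a b c :: complex
    by (simp add: algebra_simps)
  have eq: "[:c, b, a, 1:] = [:- a, 1:] * ([:- b, 1:] * [:- c, 1:]) \<longleftrightarrow> sys3 1 (a, b, c, 0) = (0, 0, 0, 0)"
    if "c \<noteq> 0" for a b c
  proof -
    have "c = - (a * b * c) \<longleftrightarrow> a * b = - 1"
      using that by algebra
    moreover have "a = - (a + b + c) \<longleftrightarrow> c = - (2 * a + b)"
      by (intro iffI; algebra)
    ultimately show ?thesis
      unfolding sys3_zero_iff prod pCons_eq_iff by blast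
  qed
  show ?thesis
  proof (intro equalityI subsetI)
    fix p assume "p \<in> {p \<in> ulam_polys 3. coeff p 0 \<noteq> 0}"
    then obtain a b c where p: "p = [:c, b, a, 1:]" "p = [:- a, 1:] * ([:- b, 1:] * [:- c, 1:])" and "coeff p 0 \<noteq> 0"
      unfolding mem_Collect_eq mem_ulam_polys_3 by blast
    then have "c \<noteq> 0"
      by (metis coeff_pCons_0)
    then have "sys3 1 (a, b, c, 0) = (0, 0, 0, 0)"
      using eq p by metis
    then show "p \<in> (\<lambda>(a, b, c, d). [:c, b, a, 1:]) `
        {x. sys3 1 x = (0, 0, 0, 0) \<and> linear_form last3 x \<noteq> 0}"
      using p(1) \<open>c \<noteq> 0\<close>
      by (intro image_eqI[of _ _ "(a, b, c, 0)"]) (simp_all only: mem_Collect_eq prod.case simp_thms linear_form_last)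
  next
    fix p assume "p \<in> (\<lambda>(a, b, c, d). [:c, b, a, 1:]) `
        {x. sys3 1 x = (0, 0, 0, 0) \<and> linear_form last3 x \<noteq> 0}"
    then obtain a b c d where abc: "p = [:c, b, a, 1:]" "sys3 1 (a, b, c, d) = (0, 0, 0, 0)" "c \<noteq> 0"
      by (auto simp: linear_form_last simp del: linear_form.simps sys3.simps)
    moreover have "d = 0"
      using abc(2) unfolding sys3_zero_iff by blast
    ultimately show "p \<in> {p \<in> ulam_polys 3. coeff p 0 \<noteq> 0}"
      unfolding mem_Collect_eq mem_ulam_polys_3 using eq[of c b a] by (metis coeff_pCons_0)
  qed
qed

text \<open>The polynomial is \<open>x^2 + x - 2 = (x - 1) * (x + 2)\<close>.\<close>

lemma ulam_2_nonzero: "{p \<in> ulam_polys 2. coeff p 0 \<noteq> 0} = {[:- 2, 1, 1:]}"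
proof -
  have "[:b, a, 1:] = [:- a, 1:] * [:- b, 1:] \<longleftrightarrow> a = 1 \<and> b = - 2" if "b \<noteq> 0" for a b :: complex
  proof -
    have "[:b, a, 1:] = [:- a, 1:] * [:- b, 1:] \<longleftrightarrow> b = a * b \<and> a = - (a + b)"
      by simp
    then show ?thesis
      using that by auto algebra
  qed
  note eq = this
  show ?thesis
  proof (intro equalityI subsetI)
    fix p assume "p \<in> {p \<in> ulam_polys 2. coeff p 0 \<noteq> 0}"
    then obtain a b where p: "p = [:b, a, 1:]" "p = [:- a, 1:] * [:- b, 1:]" and "coeff p 0 \<noteq> 0"
      unfolding mem_Collect_eq mem_ulam_polys_2 by blast
    then have "b \<noteq> 0"
      by (metis coeff_pCons_0)
    then show "p \<in> {[:- 2, 1, 1:]}"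
      using eq p by (metis singletonI)
  next
    fix p :: "complex poly" assume "p \<in> {[:- 2, 1, 1:]}"
    then show "p \<in> {p \<in> ulam_polys 2. coeff p 0 \<noteq> 0}"
      unfolding mem_Collect_eq mem_ulam_polys_2 by (auto intro!: exI[of _ 1] exI[of _ "- 2"])
  qed
qed

text \<open>In contrast to degree 4 no zero is lost to a vanishing last coefficient: the bounds for
  all zeros and for those with nonzero \<open>e\<close> meet at 96.\<close>

lemma card_ulam_5_nonzero:
  "finite {p \<in> ulam_polys 5. coeff p 0 \<noteq> 0} \<and> card {p \<in> ulam_polys 5. coeff p 0 \<noteq> 0} = 96"
proof -
  let ?Z = "{x. sys5 1 x = (0, 0, 0, 0) \<and> linear_form last5 x \<noteq> 0}"
  have "?Z \<subseteq> zeros5"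
    by (auto simp: zeros5_def)
  then have "finite ?Z" "card ?Z \<le> 96"
    using zeros5_bound by (meson finite_subset card_mono order_trans)+
  moreover have "inj_on (\<lambda>(a, b, c, d). [:linear_form last5 (a, b, c, d), d, c, b, a, 1:]) ?Z"
    by (auto simp: inj_on_def)
  ultimately show ?thesis
    using zeros5_ge by (simp add: ulam_5_nonzero card_image)
qed

lemma card_ulam_4_nonzero:
  "finite {p \<in> ulam_polys 4. coeff p 0 \<noteq> 0} \<and> card {p \<in> ulam_polys 4. coeff p 0 \<noteq> 0} = 17"
proof -
  let ?Z = "{x. sys4 1 x = (0, 0, 0, 0) \<and> linear_form last4 x \<noteq> 0}"
  \<comment> \<open>The cubic with coefficients \<open>1, - 1, - 1\<close> gives a spurious zero: multiplied by \<open>x\<close> it is a double solution in degree 4.\<close>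
  have "(1, - 1, - 1, 0) \<in> zeros4"
    by (simp add: zeros4_def sys4_zero_iff del: sys4.simps)
  moreover have "?Z \<subseteq> zeros4 - {(1, - 1, - 1, 0)}"
    by (auto simp: zeros4_def linear_form_last simp del: linear_form.simps sys4.simps)
  then have "finite ?Z" "card ?Z \<le> card (zeros4 - {(1, - 1, - 1, 0)})"
    using zeros4_bound by (meson finite_subset card_mono finite_Diff)+
  ultimately have "finite ?Z" "card ?Z \<le> 17"
    using zeros4_bound by (auto simp: card_Diff_singleton)
  moreover have "inj_on (\<lambda>(a, b, c, d). [:d, c, b, a, 1:]) ?Z"
    by (auto simp: inj_on_def)
  ultimately show ?thesis
    using zeros4_ge by (simp add: ulam_4_nonzero card_image)
qed

lemma card_ulam_3_nonzero:
  "finite {p \<in> ulam_polys 3. coeff p 0 \<noteq> 0} \<and> card {p \<in> ulam_polys 3. coeff p 0 \<noteq> 0} = 4"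
proof -
  let ?Z = "{x. sys3 1 x = (0, 0, 0, 0) \<and> linear_form last3 x \<noteq> 0}"
  have "?Z \<subseteq> zeros3"
    by (auto simp: zeros3_def)
  then have "finite ?Z" "card ?Z \<le> 4"
    using zeros3_bound by (meson finite_subset card_mono order_trans)+
  moreover have "inj_on (\<lambda>(a, b, c, d). [:c, b, a, 1:]) ?Z"
    by (auto simp: inj_on_def)
  ultimately show ?thesis
    using zeros3_ge by (simp add: ulam_3_nonzero card_image)
qed

theorem mainTheorem4:
  shows "card (ulam_polys 1) = 1 \<and> card (ulam_polys 2) = 2 \<and> card (ulam_polys 3) = 6 \<and>
         card (ulam_polys 4) = 23 \<and> card (ulam_polys 5) = 119"
proof -
  \<comment> \<open>The successive increments are 1, 4, 17 and 96; finiteness is carried along for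
    \<open>card_ulam_polys_Suc\<close>.\<close>
  have U1: "finite (ulam_polys 1) \<and> card (ulam_polys 1) = 1"
    unfolding ulam_polys_1 by simp
  have U2: "finite (ulam_polys 2) \<and> card (ulam_polys 2) = 2"
    using card_ulam_polys_Suc[of 1, unfolded Suc_1] U1 ulam_2_nonzero by simp
  have U3: "finite (ulam_polys 3) \<and> card (ulam_polys 3) = 6"
    using card_ulam_polys_Suc[of 2] U2 card_ulam_3_nonzero by simp
  have U4: "finite (ulam_polys 4) \<and> card (ulam_polys 4) = 23"
    using card_ulam_polys_Suc[of 3] U3 card_ulam_4_nonzero by simp
  have U5: "finite (ulam_polys 5) \<and> card (ulam_polys 5) = 119"
    using card_ulam_polys_Suc[of 4] U4 card_ulam_5_nonzero by simp
  show ?thesis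
    using U1 U2 U3 U4 U5 by simp
qed

end
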